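(* Let $\mathcal{H}$ be a separable complex Hilbert space. Given a complex symmetric operator $T\in\mathcal{B}(\mathcal{H})$ and $\varepsilon>0$, there exists $K\in\mathcal{B}(\mathcal{H})$ with $\|K\|<\varepsilon$ such that $T+K$ is complex symmetric and the spectrum $\sigma(T+K)$ has only finitely many connected components.
   Context: $\mathcal{B}(\mathcal{H})$ is the algebra of bounded linear operators on $\mathcal{H}$. A conjugation on $\mathcal{H}$ is a conjugate-linear map $C:\mathcal{H}\to\mathcal{H}$ that is invertible with $C^{-1}=C$ and satisfies $\langle Cx,Cy\rangle=\langle y,x\rangle$ for all $x,y\in\mathcal{H}$. An operator $T\in\mathcal{B}(\mathcal{H})$ is complex symmetric if there is a conjugation $C$ on $\mathcal{H}$ with $CTC=T^*$. *)

theory Defs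
  imports "HOL-Analysis.Analysis"
begin

class complex_vector = real_vector +
  fixes scaleC :: "complex \<Rightarrow> 'a \<Rightarrow> 'a"  (infixr "*\<^sub>C" 75)
  assumes scaleC_add_right: "c *\<^sub>C (x + y) = c *\<^sub>C x + c *\<^sub>C y"
    and scaleC_add_left: "(c + d) *\<^sub>C x = c *\<^sub>C x + d *\<^sub>C x"
    and scaleC_scaleC: "c *\<^sub>C (d *\<^sub>C x) = (c * d) *\<^sub>C x"
    and scaleC_one: "1 *\<^sub>C x = x"
    and scaleR_scaleC: "r *\<^sub>R x = complex_of_real r *\<^sub>C x"

text \<open>The complex inner product is linear in its first argument. It is tied to the
  real structure of the library by \<open>Re\<close>, so that norm, metric and topology are those of the
  complex inner product; positive definiteness is inherited from \<open>real_inner\<close> (see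
  \<open>cinner_self\<close> and \<open>cinner_eq_zero_iff\<close> below).\<close>

class complex_inner = complex_vector + real_inner +
  fixes cinner :: "'a \<Rightarrow> 'a \<Rightarrow> complex"
  assumes cinner_add_left: "cinner (x + y) z = cinner x z + cinner y z"
    and cinner_scaleC_left: "cinner (c *\<^sub>C x) y = c * cinner x y"
    and cinner_commute: "cinner x y = cnj (cinner y x)"
    and inner_Re_cinner: "inner x y = Re (cinner x y)"

class complex_hilbert_space = complex_inner + complete_space

lemma cinner_self: "cinner x x = complex_of_real ((norm x)\<^sup>2)"
  for x :: "'a::complex_inner"
proof -
  have "cinner x x = cnj (cinner x x)"
    by (rule cinner_commute)
  then have "Im (cinner x x) = 0"
    by (simp add: complex_eq_iff)
  then show ?thesis
    by (simp add: complex_eq_iff inner_Re_cinner [symmetric] power2_norm_eq_inner)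
qed

lemma cinner_eq_zero_iff: "cinner x x = 0 \<longleftrightarrow> x = 0"
  for x :: "'a::complex_inner"
  by (simp add: cinner_self)

instantiation complex :: complex_hilbert_space
begin

definition scaleC_complex :: "complex \<Rightarrow> complex \<Rightarrow> complex"
  where "scaleC_complex c x = c * x"

definition cinner_complex :: "complex \<Rightarrow> complex \<Rightarrow> complex"
  where "cinner_complex x y = x * cnj y"

instance
  by standard
    (simp_all add: scaleC_complex_def cinner_complex_def inner_complex_def
      algebra_simps scaleR_conv_of_real)

end

text \<open>\<open>\<B>(\<H>)\<close> consists of the functions satisfying \<open>bounded_clinear\<close>, with operator norm \<open>onorm\<close>.\<close>

definition bounded_clinear :: "('a::complex_inner \<Rightarrow> 'a) \<Rightarrow> bool"
  where "bounded_clinear T \<longleftrightarrow> bounded_linear T \<and> (\<forall>c x. T (c *\<^sub>C x) = c *\<^sub>C T x)"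

text \<open>For a bounded operator on a Hilbert space the adjoint exists by the Riesz representation
  theorem, and it is unique; for other functions the value may be arbitrary.\<close>

definition cadjoint :: "('a::complex_inner \<Rightarrow> 'a) \<Rightarrow> 'a \<Rightarrow> 'a"
  where "cadjoint T = (SOME S. \<forall>x y. cinner (T x) y = cinner x (S y))"

definition conjugation :: "('a::complex_inner \<Rightarrow> 'a) \<Rightarrow> bool"
  where "conjugation C \<longleftrightarrow>
    (\<forall>x y. C (x + y) = C x + C y) \<and>
    (\<forall>c x. C (c *\<^sub>C x) = cnj c *\<^sub>C C x) \<and>
    C \<circ> C = id \<and>
    (\<forall>x y. cinner (C x) (C y) = cinner y x)"

definition complex_symmetric :: "('a::complex_inner \<Rightarrow> 'a) \<Rightarrow> bool"
  where "complex_symmetric T \<longleftrightarrow>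
    bounded_clinear T \<and> (\<exists>C. conjugation C \<and> C \<circ> T \<circ> C = cadjoint T)"

definition spectrum :: "('a::complex_inner \<Rightarrow> 'a) \<Rightarrow> complex set"
  where "spectrum T = {z. \<not> (\<exists>S. bounded_clinear S \<and>
    S \<circ> (\<lambda>x. T x - z *\<^sub>C x) = id \<and> (\<lambda>x. T x - z *\<^sub>C x) \<circ> S = id)}"

end

theory Submission
  imports Defs "HOL-Complex_Analysis.Complex_Analysis"
begin

text \<open>
  Fix a conjugation \<open>C\<close> with \<open>C T C = T*\<close>; all perturbations will be symmetric with respect to the same
  \<open>C\<close>. Call \<open>z\<close> an essential point of \<open>T\<close> if \<open>T - z\<close> is not bounded below on any orthogonal
  complement of finitely many vectors (\<open>ess_bounded_below\<close> is the negation). The essential points form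
  a compact set, so finitely many discs of a small radius \<open>r\<close> centred at essential points cover it. (If
  there are none, take \<open>K = 0\<close> and \<open>S = T\<close> below.)

  If \<open>K\<close> can be chosen such that \<open>T + K\<close> has as its spectrum the union of these closed discs and of
  the spectrum of an operator \<open>S\<close> without essential points outside the open discs, the theorem
  follows. Indeed, near a point that is not essential for \<open>S\<close>, the equation \<open>(S - z) x = 0\<close> reduces to
  a finite linear system that depends holomorphically on \<open>z\<close>; hence near each of its points outside
  the open discs the spectrum of \<open>S\<close> is either that single point or a full ball
  (\<open>spectrum_near_ess_bounded_below\<close>). By compactness finitely many points, balls and discs make up
  the whole spectrum, and a finite union of connected sets has finitely many components. Symmetry
  enters here through the fact that \<open>C\<close> exchanges the kernel of \<open>S - z\<close> with the orthogonal
  complement of its range, so that \<open>S - z\<close> is invertible as soon as it is bounded below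
  (\<open>C_symmetric_spectrum_iff\<close>).

  To construct \<open>K\<close> (\<open>fill_discs\<close>), pick an orthonormal sequence of better and better approximate
  eigenvectors \<open>e n\<close> for essential points \<open>\<mu> n\<close>, all \<open>e n\<close> and \<open>C (e m)\<close> being mutually orthogonal. A
  small \<open>C\<close>-symmetric operator \<open>L\<close>, a norm limit of finite-rank operators, makes them exact: with
  \<open>S = T - L\<close> the \<open>e n\<close> are eigenvectors of \<open>S\<close> and the \<open>C (e n)\<close> are eigenvectors of the adjoint of
  \<open>S\<close>, and \<open>S\<close> has no new essential points. So \<open>S\<close> is block triangular with two diagonal corner
  blocks, whose entries \<open>\<mu> n\<close> can be moved by arbitrary amounts \<open>c n\<close> of modulus at most \<open>r\<close>. Choosing
  the numbers \<open>\<mu> n + c n\<close> dense in the discs puts the discs into the spectrum. Outside the discs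
  nothing changes, because there the old and the new operator differ by invertible diagonal factors
  (\<open>bounded_below_change_eigenvalues\<close>).
\<close>

section \<open>Complex inner product spaces\<close>

interpretation complex_scaling: vector_space "scaleC :: complex \<Rightarrow> 'a \<Rightarrow> 'a::complex_vector"
  by standard (simp_all add: scaleC_add_right scaleC_add_left scaleC_scaleC scaleC_one)

lemma cinner_add_right: "cinner x (y + z) = cinner x y + cinner x z"
  for x :: "'a::complex_inner"
  by (metis cinner_add_left cinner_commute complex_cnj_add)

lemma cinner_scaleC_right: "cinner x (c *\<^sub>C y) = cnj c * cinner x y"
  for x :: "'a::complex_inner"
  by (metis cinner_scaleC_left cinner_commute complex_cnj_mult)

lemma cinner_zero_left [simp]: "cinner 0 (y::'a::complex_inner) = 0"
  using cinner_add_left [of 0 0 y] by simp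

lemma cinner_zero_right [simp]: "cinner (y::'a::complex_inner) 0 = 0"
  using cinner_add_right [of y 0 0] by simp

lemma cinner_minus_left: "cinner (- x) y = - cinner x y" for x :: "'a::complex_inner"
  using cinner_add_left [of x "- x" y] by (simp add: eq_neg_iff_add_eq_0 add.commute)

lemma cinner_minus_right: "cinner x (- y) = - cinner x y" for x :: "'a::complex_inner"
  using cinner_add_right [of x y "- y"] by (simp add: eq_neg_iff_add_eq_0 add.commute)

lemma cinner_diff_left: "cinner (x - y) z = cinner x z - cinner y z" for x :: "'a::complex_inner"
  using cinner_add_left [of x "- y" z] by (simp add: cinner_minus_left)

lemma cinner_diff_right: "cinner x (y - z) = cinner x y - cinner x z" for x :: "'a::complex_inner"
  using cinner_add_right [of x y "- z"] by (simp add: cinner_minus_right)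

lemma cinner_sum_left: "cinner (sum f A) y = (\<Sum>i\<in>A. cinner (f i) y)"
  for y :: "'a::complex_inner"
  by (induction A rule: infinite_finite_induct) (simp_all add: cinner_add_left)

lemma cinner_sum_right: "cinner y (sum f A) = (\<Sum>i\<in>A. cinner y (f i))"
  for y :: "'a::complex_inner"
  by (induction A rule: infinite_finite_induct) (simp_all add: cinner_add_right)

lemmas cinner_simps = cinner_add_left cinner_add_right cinner_diff_left cinner_diff_right
  cinner_scaleC_left cinner_scaleC_right cinner_sum_left cinner_sum_right
  cinner_minus_left cinner_minus_right

lemma norm_scaleC: "norm (c *\<^sub>C x) = cmod c * norm x" for x :: "'a::complex_inner"
proof -
  have "complex_of_real ((norm (c *\<^sub>C x))\<^sup>2) = c * cnj c * complex_of_real ((norm x)\<^sup>2)"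
    unfolding cinner_self [symmetric] by (simp add: cinner_simps)
  also have "\<dots> = complex_of_real ((cmod c * norm x)\<^sup>2)"
    by (simp add: power_mult_distrib flip: complex_norm_square)
  finally have "(norm (c *\<^sub>C x))\<^sup>2 = (cmod c * norm x)\<^sup>2"
    using of_real_eq_iff by blast
  then show ?thesis
    by (simp add: power2_eq_iff_nonneg)
qed

lemma norm_cinner_le: "cmod (cinner x y) \<le> norm x * norm y" for x :: "'a::complex_inner"
proof -
  \<comment> \<open>Rotating \<open>x\<close> by the phase of the inner product reduces to the real Cauchy-Schwarz inequality.\<close>
  define u where "u = cnj (sgn (cinner x y))"
  have "complex_of_real (cmod (cinner x y)) = u * cinner x y"
    using complex_norm_square [of "cinner x y"]
    by (cases "cinner x y = 0") (simp_all add: u_def sgn_eq field_simps power2_eq_square)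
  then have "cmod (cinner x y) = Re (cinner (u *\<^sub>C x) y)"
    by (metis Re_complex_of_real cinner_scaleC_left)
  also have "\<dots> \<le> norm (u *\<^sub>C x) * norm y"
    using norm_cauchy_schwarz [of "u *\<^sub>C x" y] by (simp add: inner_Re_cinner)
  also have "\<dots> \<le> norm x * norm y"
    by (simp add: norm_scaleC u_def norm_sgn)
  finally show ?thesis .
qed

lemma bounded_linear_scaleC_right: "bounded_linear (\<lambda>x::'a::complex_inner. c *\<^sub>C x)"
  by (rule bounded_linear_intro [where K = "cmod c"])
    (simp_all add: scaleC_add_right norm_scaleC scaleR_scaleC scaleC_scaleC mult.commute)

lemma bounded_linear_cinner_left: "bounded_linear (\<lambda>x::'a::complex_inner. cinner x y)"
  by (rule bounded_linear_intro [where K = "norm y"])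
    (simp_all add: cinner_simps scaleR_scaleC [where 'a = 'a] scaleR_conv_of_real norm_cinner_le)

lemma cinner_eqI: "(\<And>z. cinner x z = cinner y z) \<Longrightarrow> x = y" for x :: "'a::complex_inner"
  by (metis cinner_diff_left cinner_eq_zero_iff right_minus_eq)

lemma norm_add_orthogonal:
  "cinner x y = 0 \<Longrightarrow> (norm (x + y))\<^sup>2 = (norm x)\<^sup>2 + (norm y)\<^sup>2" for x :: "'a::complex_inner"
  by (simp add: norm_add_Pythagorean orthogonal_def inner_Re_cinner)

section \<open>Bounded operators\<close>

lemma bounded_clinearI:
  assumes "\<And>x y. A (x + y) = A x + A y" "\<And>c x. A (c *\<^sub>C x) = c *\<^sub>C A x"
    and "\<And>x. norm (A x) \<le> norm x * M"
  shows "bounded_clinear A"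
  unfolding bounded_clinear_def
  using assms by (auto intro!: bounded_linear_intro [of A M] simp: scaleR_scaleC)

lemma bounded_clinear_bounded_linear: "bounded_clinear A \<Longrightarrow> bounded_linear A"
  by (simp add: bounded_clinear_def)

lemma bounded_clinear_scaleC: "bounded_clinear A \<Longrightarrow> A (c *\<^sub>C x) = c *\<^sub>C A x"
  by (simp add: bounded_clinear_def)

lemma bounded_clinear_add: "bounded_clinear A \<Longrightarrow> A (x + y) = A x + A y"
  by (simp add: bounded_clinear_def linear_simps)

lemma bounded_clinear_diff: "bounded_clinear A \<Longrightarrow> A (x - y) = A x - A y"
  by (simp add: bounded_clinear_def linear_simps)

lemma bounded_clinear_zero: "bounded_clinear A \<Longrightarrow> A 0 = 0"
  by (simp add: bounded_clinear_def linear_simps)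

lemma bounded_clinear_sum: "bounded_clinear A \<Longrightarrow> A (sum f I) = (\<Sum>i\<in>I. A (f i))"
  by (simp add: bounded_clinear_def bounded_linear.linear linear_sum)

lemmas bounded_clinear_simps = bounded_clinear_scaleC bounded_clinear_add bounded_clinear_diff
  bounded_clinear_zero bounded_clinear_sum

lemma bounded_clinear_id: "bounded_clinear (\<lambda>x. x)"
  by (simp add: bounded_clinear_def)

lemma bounded_clinear_plus:
  "bounded_clinear A \<Longrightarrow> bounded_clinear B \<Longrightarrow> bounded_clinear (\<lambda>x. A x + B x)"
  by (simp add: bounded_clinear_def bounded_linear_add scaleC_add_right)

lemma bounded_clinear_scale:
  assumes "bounded_clinear A" shows "bounded_clinear (\<lambda>x. c *\<^sub>C A x)"
  using assms bounded_linear_compose [OF bounded_linear_scaleC_right, of A c]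
  by (simp add: bounded_clinear_def scaleC_scaleC mult.commute)

lemma bounded_clinear_minus:
  assumes "bounded_clinear A" "bounded_clinear B" shows "bounded_clinear (\<lambda>x. A x - B x)"
  using assms by (simp add: bounded_clinear_def bounded_linear_sub complex_scaling.scale_right_diff_distrib)

lemma bounded_clinear_shift: "bounded_clinear A \<Longrightarrow> bounded_clinear (\<lambda>x. A x - z *\<^sub>C x)"
  by (rule bounded_clinear_minus [OF _ bounded_clinear_scale [OF bounded_clinear_id]])

lemma bounded_clinear_rank_one: "bounded_clinear (\<lambda>x. cinner x u *\<^sub>C v)"
  by (rule bounded_clinearI [where M = "norm u * norm v"])
    (simp_all add: cinner_simps scaleC_add_left scaleC_scaleC norm_scaleC
      mult_right_mono norm_cinner_le flip: mult.assoc)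

lemma bounded_clinear_finite_sum:
  "(\<And>i. i \<in> I \<Longrightarrow> bounded_clinear (A i)) \<Longrightarrow> bounded_clinear (\<lambda>x. \<Sum>i\<in>I. A i x)"
proof (induction I rule: infinite_finite_induct)
  case (insert i I)
  then show ?case using bounded_clinear_plus [of "A i"] by simp
qed (auto intro: bounded_clinearI [where M = 0])

lemma bounded_clinear_bound:
  assumes "bounded_clinear A"
  obtains M where "M > 0" "\<And>x. norm (A x) \<le> M * norm x"
  using bounded_linear.pos_bounded [OF bounded_clinear_bounded_linear [OF assms]]
  by (metis mult.commute)

section \<open>Nearest points and adjoints\<close>

text \<open>A minimizing sequence for the distance to \<open>M\<close> is Cauchy by the parallelogram law; its
  limit is a nearest point, and the difference to a nearest point is orthogonal to \<open>M\<close>.\<close>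

lemma closed_subspace_orthogonal_vector:
  fixes M :: "'a::complex_hilbert_space set"
  assumes closed: "closed M" and zero: "0 \<in> M"
    and add: "\<And>x y. x \<in> M \<Longrightarrow> y \<in> M \<Longrightarrow> x + y \<in> M"
    and scale: "\<And>c x. x \<in> M \<Longrightarrow> c *\<^sub>C x \<in> M"
    and p: "p \<notin> M"
  obtains u where "u \<noteq> 0" "\<And>x. x \<in> M \<Longrightarrow> cinner u x = 0"
proof -
  define d where "d = infdist p M"
  have M: "M \<noteq> {}" using zero by auto
  have d_le: "d \<le> norm (p - x)" if "x \<in> M" for x
    using infdist_le [OF that, of p] by (simp add: d_def dist_norm)
  have d0: "d \<ge> 0" by (simp add: d_def infdist_nonneg)
  have "\<exists>x\<in>M. norm (p - x) < d + 1 / Suc n" for n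
  proof (rule ccontr)
    assume "\<not> ?thesis"
    then have "d + 1 / Suc n \<le> infdist p M"
      using M by (auto simp: infdist_notempty dist_norm intro!: cINF_greatest)
    then show False by (simp add: d_def)
  qed
  then obtain X where X: "\<And>n. X n \<in> M" and Xd: "\<And>n. norm (p - X n) < d + 1 / Suc n"
    by metis
  have par: "(norm (X m - X n))\<^sup>2 \<le> 2 * (norm (p - X m))\<^sup>2 + 2 * (norm (p - X n))\<^sup>2 - 4 * d\<^sup>2" for m n
  proof -
    let ?m = "(1/2) *\<^sub>C (X m + X n)"
    have "d \<le> norm (p - ?m)" using X by (intro d_le scale add)
    then have d2: "d\<^sup>2 \<le> (norm (p - ?m))\<^sup>2" using d0 by (intro power_mono)
    have "(p - X m) + (p - X n) = 2 *\<^sub>R (p - ?m)"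
      by (simp add: scaleR_scaleC complex_scaling.scale_right_diff_distrib scaleC_scaleC)
        (simp add: complex_scaling.scale_left_distrib [of 1 1, simplified])
    then have "norm ((p - X m) + (p - X n)) = 2 * norm (p - ?m)" by simp
    moreover have "(norm ((p - X m) + (p - X n)))\<^sup>2 + (norm ((p - X m) - (p - X n)))\<^sup>2
        = 2 * (norm (p - X m))\<^sup>2 + 2 * (norm (p - X n))\<^sup>2"
      by (simp add: power2_norm_eq_inner inner_simps)
    moreover have "norm ((p - X m) - (p - X n)) = norm (X m - X n)"
      by (simp add: norm_minus_commute)
    ultimately show ?thesis using d2 by (simp add: power_mult_distrib)
  qed
  have lim0: "(\<lambda>n. norm (p - X n)) \<longlonglongrightarrow> d"
  proof (rule tendsto_sandwich [of "\<lambda>_. d" _ _ "\<lambda>n. d + 1 / Suc n"])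
    show "(\<lambda>n. d + 1 / Suc n) \<longlonglongrightarrow> d" by real_asymp
    show "\<forall>\<^sub>F n in sequentially. norm (p - X n) \<le> d + 1 / Suc n"
      using Xd by (intro always_eventually allI less_imp_le)
    show "\<forall>\<^sub>F n in sequentially. d \<le> norm (p - X n)"
      by (intro always_eventually allI d_le X)
  qed simp
  have "Cauchy X"
  proof (rule metric_CauchyI)
    fix e :: real assume e: "e > 0"
    have "(\<lambda>n. 2 * (norm (p - X n))\<^sup>2) \<longlonglongrightarrow> 2 * d\<^sup>2" by (intro tendsto_intros lim0)
    then have "\<forall>\<^sub>F n in sequentially. 2 * (norm (p - X n))\<^sup>2 < 2 * d\<^sup>2 + e\<^sup>2 / 2"
      by (rule order_tendstoD) (use e in simp)
    then obtain N where N: "\<And>n. n \<ge> N \<Longrightarrow> 2 * (norm (p - X n))\<^sup>2 < 2 * d\<^sup>2 + e\<^sup>2 / 2"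
      by (auto simp: eventually_sequentially)
    have "dist (X m) (X n) < e" if "m \<ge> N" "n \<ge> N" for m n
    proof -
      have "(norm (X m - X n))\<^sup>2 < e\<^sup>2" using par [of m n] N [OF that(1)] N [OF that(2)] by simp
      then show ?thesis using e by (simp add: dist_norm power_less_imp_less_base)
    qed
    then show "\<exists>N. \<forall>m\<ge>N. \<forall>n\<ge>N. dist (X m) (X n) < e" by blast
  qed
  then obtain q where q: "X \<longlonglongrightarrow> q" by (metis Cauchy_convergent_iff convergent_def)
  have qM: "q \<in> M" using closed_sequentially [OF closed X q] .
  have "(\<lambda>n. norm (p - X n)) \<longlonglongrightarrow> norm (p - q)" by (intro tendsto_intros q)
  then have nq: "norm (p - q) = d" using lim0 LIMSEQ_unique by blast
  show thesis
  proof
    show "p - q \<noteq> 0" using p qM by auto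
    fix x assume x: "x \<in> M"
    show "cinner (p - q) x = 0"
    proof (cases "x = 0")
      case False
      define c where "c = cinner (p - q) x / cinner x x"
      have nz: "cinner x x \<noteq> 0" using False by (simp add: cinner_eq_zero_iff)
      have o: "cinner ((p - q) - c *\<^sub>C x) (c *\<^sub>C x) = 0"
        using nz by (simp add: cinner_simps c_def)
      have "d \<le> norm (p - (q + c *\<^sub>C x))" by (intro d_le add qM scale x)
      then have "d\<^sup>2 \<le> (norm ((p - q) - c *\<^sub>C x))\<^sup>2" using d0 by (simp add: diff_diff_eq power_mono)
      moreover have "d\<^sup>2 = (norm ((p - q) - c *\<^sub>C x))\<^sup>2 + (norm (c *\<^sub>C x))\<^sup>2"
        using norm_add_orthogonal [OF o] nq by simp
      ultimately have "c *\<^sub>C x = 0" by simp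
      then show ?thesis using False nz by (simp add: c_def)
    qed simp
  qed
qed

text \<open>The kernel of a nonzero functional has a one-dimensional orthogonal complement.\<close>

lemma Riesz_representation:
  fixes \<phi> :: "'a::complex_hilbert_space \<Rightarrow> complex"
  assumes \<phi>: "bounded_linear \<phi>" and scale: "\<And>c x. \<phi> (c *\<^sub>C x) = c * \<phi> x"
  obtains w where "\<And>x. \<phi> x = cinner x w"
proof (cases "\<forall>x. \<phi> x = 0")
  case True
  then show thesis using that [of 0] by simp
next
  case False
  then obtain p where p: "\<phi> p \<noteq> 0" by auto
  interpret bounded_linear \<phi> by (fact \<phi>)
  have "closed {x. \<phi> x = 0}"
    by (intro closed_Collect_eq continuous_intros linear_continuous_on \<phi>)
  then obtain u where u: "u \<noteq> 0" and orth: "\<And>x. \<phi> x = 0 \<Longrightarrow> cinner u x = 0"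
    using p by (elim closed_subspace_orthogonal_vector [of _ p]) (auto simp: add assms(2) zero)
  have uu: "cinner u u \<noteq> 0" using u by (simp add: cinner_eq_zero_iff)
  have "\<phi> u \<noteq> 0" using orth uu by auto
  have "\<phi> x = cinner x (cnj (\<phi> u / cinner u u) *\<^sub>C u)" for x
  proof -
    have "\<phi> (\<phi> x *\<^sub>C u - \<phi> u *\<^sub>C x) = 0" by (simp add: diff assms(2))
    then have "cinner (\<phi> x *\<^sub>C u - \<phi> u *\<^sub>C x) u = 0"
      using orth cinner_commute by (metis complex_cnj_zero)
    then show ?thesis using uu by (simp add: cinner_simps field_simps)
  qed
  then show thesis by (rule that)
qed

lemma cadjoint_eqI:
  assumes "\<And>x y. cinner (T x) y = cinner x (S y)"
  shows "cadjoint T = S"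
proof -
  have "\<forall>x y. cinner (T x) y = cinner x (cadjoint T y)"
    unfolding cadjoint_def by (rule someI_ex [of "\<lambda>S. \<forall>x y. cinner (T x) y = cinner x (S y)"]) (use assms in blast)
  then have eq: "cinner x (cadjoint T y) = cinner x (S y)" for x y
    using assms [of x y] by simp
  have "cinner (cadjoint T y) x = cinner (S y) x" for x y
    using arg_cong [OF eq [of x y], of cnj] by (simp flip: cinner_commute)
  then show ?thesis using cinner_eqI by (metis ext)
qed

text \<open>Since \<open>cadjoint\<close> is a choice among all adjoints, it is an adjoint only once one is known to
  exist; the Riesz representation of \<open>x \<mapsto> cinner (T x) y\<close> supplies it.\<close>

lemma cinner_cadjoint:
  fixes T :: "'a::complex_hilbert_space \<Rightarrow> 'a"
  assumes T: "bounded_clinear T"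
  shows "cinner (T x) y = cinner x (cadjoint T y)"
proof -
  have "\<exists>w. \<forall>x. cinner (T x) y = cinner x w" for y
  proof -
    have "bounded_linear (\<lambda>x. cinner (T x) y)"
      by (intro bounded_linear_compose [OF bounded_linear_cinner_left]
          bounded_clinear_bounded_linear T)
    then obtain w where "\<And>x. cinner (T x) y = cinner x w"
      by (rule Riesz_representation) (simp_all add: T bounded_clinear_scaleC cinner_scaleC_left)
    then show ?thesis by blast
  qed
  then obtain S where S: "\<And>x y. cinner (T x) y = cinner x (S y)" by metis
  then have "cadjoint T = S" by (rule cadjoint_eqI)
  then show ?thesis using S by simp
qed

section \<open>Operators symmetric with respect to a conjugation\<close>

text \<open>Symmetry of the complex bilinear form \<open>(x, y) \<mapsto> cinner (A x) (C y)\<close> is the identity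
  \<open>C A C = A*\<close> freed from any mention of the adjoint.\<close>

definition C_symmetric :: "('a::complex_inner \<Rightarrow> 'a) \<Rightarrow> ('a \<Rightarrow> 'a) \<Rightarrow> bool"
  where "C_symmetric C A \<longleftrightarrow>
    bounded_clinear A \<and> (\<forall>x y. cinner (A x) (C y) = cinner (A y) (C x))"

context
  fixes C :: "'a::complex_inner \<Rightarrow> 'a"
  assumes C: "conjugation C"
begin

lemma conjugation_add: "C (x + y) = C x + C y"
  and conjugation_scaleC: "C (c *\<^sub>C x) = cnj c *\<^sub>C C x"
  and cinner_conjugation: "cinner (C x) (C y) = cinner y x"
  using C unfolding conjugation_def by blast+

lemma conjugation_involution: "C (C x) = x"
  using C unfolding conjugation_def by (metis comp_apply id_apply)

lemma norm_conjugation: "norm (C x) = norm x"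
proof -
  have "complex_of_real ((norm (C x))\<^sup>2) = complex_of_real ((norm x)\<^sup>2)"
    unfolding cinner_self [symmetric] by (rule cinner_conjugation)
  then show ?thesis by (simp add: power2_eq_iff_nonneg del: of_real_power)
qed

lemma conjugation_diff: "C (x - y) = C x - C y"
  using conjugation_add [of "x - y" y] by simp

lemma cinner_conjugation_right: "cinner x (C y) = cinner y (C x)"
  using cinner_conjugation [of "C x" y] by (simp add: conjugation_involution)

lemma C_symmetric_add:
  "C_symmetric C A \<Longrightarrow> C_symmetric C B \<Longrightarrow> C_symmetric C (\<lambda>x. A x + B x)"
  by (simp add: C_symmetric_def bounded_clinear_plus cinner_simps)

lemma C_symmetric_diff:
  "C_symmetric C A \<Longrightarrow> C_symmetric C B \<Longrightarrow> C_symmetric C (\<lambda>x. A x - B x)"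
  by (simp add: C_symmetric_def bounded_clinear_minus cinner_simps)

lemma C_symmetric_shift:
  assumes "C_symmetric C A" shows "C_symmetric C (\<lambda>x. A x - z *\<^sub>C x)"
proof -
  have "cinner (A x - z *\<^sub>C x) (C y) = cinner (A y - z *\<^sub>C y) (C x)" for x y
  proof -
    have "cinner (A x) (C y) = cinner (A y) (C x)"
      using assms unfolding C_symmetric_def by blast
    then show ?thesis
      unfolding cinner_simps cinner_conjugation_right [of x y] by (rule arg_cong)
  qed
  then show ?thesis
    using assms bounded_clinear_shift unfolding C_symmetric_def by blast
qed

lemma C_symmetric_rank_one: "C_symmetric C (\<lambda>x. cinner x u *\<^sub>C C u)"
  by (simp add: C_symmetric_def bounded_clinear_rank_one cinner_simps cinner_conjugation)

lemma C_symmetric_finite_sum: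
  "(\<And>i. i \<in> I \<Longrightarrow> C_symmetric C (A i)) \<Longrightarrow> C_symmetric C (\<lambda>x. \<Sum>i\<in>I. A i x)"
  by (simp add: C_symmetric_def bounded_clinear_finite_sum cinner_simps)

lemma C_symmetric_cinner:
  assumes "C_symmetric C A" shows "cinner (A x) y = cinner x (C (A (C y)))"
proof -
  have "cinner (A x) (C (C y)) = cinner (A (C y)) (C x)"
    using assms by (simp add: C_symmetric_def)
  then show ?thesis
    using cinner_conjugation_right [of x "A (C y)"] by (simp add: conjugation_involution)
qed

lemma complex_symmetricI:
  assumes "C_symmetric C A" shows "complex_symmetric A"
proof -
  have "cadjoint A = C \<circ> A \<circ> C"
    by (rule cadjoint_eqI) (simp add: C_symmetric_cinner [OF assms])
  then show ?thesis
    using assms C by (auto simp: complex_symmetric_def C_symmetric_def)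
qed

end

lemma complex_symmetricE:
  fixes T :: "'a::complex_hilbert_space \<Rightarrow> 'a"
  assumes "complex_symmetric T"
  obtains C where "conjugation C" "C_symmetric C T"
proof -
  from assms obtain C where T: "bounded_clinear T" and C: "conjugation C"
    and ad: "C \<circ> T \<circ> C = cadjoint T"
    unfolding complex_symmetric_def by blast
  have "cinner (T x) (C y) = cinner (T y) (C x)" for x y
  proof -
    have "cinner (T x) (C y) = cinner x (C (T y))"
      using cinner_cadjoint [OF T, of x "C y"] fun_cong [OF ad, of "C y"]
      by (simp add: conjugation_involution [OF C])
    then show ?thesis using cinner_conjugation_right [OF C, of x "T y"] by simp
  qed
  then show thesis using that C T by (simp add: C_symmetric_def)
qed

section \<open>Orthonormal families\<close>

definition orthonormal_on :: "'i set \<Rightarrow> ('i \<Rightarrow> 'a::complex_inner) \<Rightarrow> bool"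
  where "orthonormal_on I e \<longleftrightarrow> (\<forall>i\<in>I. \<forall>j\<in>I. cinner (e i) (e j) = (if i = j then 1 else 0))"

lemma orthonormal_onD:
  "orthonormal_on I e \<Longrightarrow> i \<in> I \<Longrightarrow> j \<in> I \<Longrightarrow> cinner (e i) (e j) = (if i = j then 1 else 0)"
  by (simp add: orthonormal_on_def)

lemma orthonormal_on_subset: "orthonormal_on I e \<Longrightarrow> J \<subseteq> I \<Longrightarrow> orthonormal_on J e"
  unfolding orthonormal_on_def by blast

lemma orthonormal_norm:
  assumes "orthonormal_on I e" "i \<in> I" shows "norm (e i) = 1"
proof -
  have "complex_of_real ((norm (e i))\<^sup>2) = 1"
    using orthonormal_onD [OF assms(1,2,2)] by (simp add: cinner_self del: of_real_power)
  then have "(norm (e i))\<^sup>2 = 1" using of_real_eq_1_iff by blast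
  then show ?thesis by (simp add: power2_eq_1_iff) (metis norm_ge_zero not_one_le_zero neg_0_le_iff_le)
qed

lemma cinner_orthonormal_sum:
  assumes "orthonormal_on I e" "finite I" "j \<in> I"
  shows "cinner (\<Sum>i\<in>I. a i *\<^sub>C e i) (e j) = a j"
proof -
  have "cinner (\<Sum>i\<in>I. a i *\<^sub>C e i) (e j) = (\<Sum>i\<in>I. if i = j then a j else 0)"
    unfolding cinner_simps using assms by (intro sum.cong) (auto simp: orthonormal_onD)
  then show ?thesis using assms by simp
qed

lemma norm_orthonormal_sum:
  assumes "orthonormal_on I e" "finite I"
  shows "(norm (\<Sum>i\<in>I. a i *\<^sub>C e i))\<^sup>2 = (\<Sum>i\<in>I. (cmod (a i))\<^sup>2)"
proof -
  have "complex_of_real ((norm (\<Sum>i\<in>I. a i *\<^sub>C e i))\<^sup>2)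
      = (\<Sum>j\<in>I. cnj (a j) * cinner (\<Sum>i\<in>I. a i *\<^sub>C e i) (e j))"
    unfolding cinner_self [symmetric] by (subst cinner_sum_right) (simp add: cinner_scaleC_right)
  also have "\<dots> = (\<Sum>j\<in>I. complex_of_real ((cmod (a j))\<^sup>2))"
    using assms
    by (intro sum.cong) (simp_all add: cinner_orthonormal_sum complex_norm_square [symmetric] mult.commute
        del: of_real_power)
  finally show ?thesis by (simp only: of_real_sum [symmetric] of_real_eq_iff)
qed

lemma orthonormal_residual:
  assumes "orthonormal_on I e" "finite I" "j \<in> I"
  shows "cinner (x - (\<Sum>i\<in>I. cinner x (e i) *\<^sub>C e i)) (e j) = 0"
  using cinner_orthonormal_sum [OF assms] by (simp add: cinner_diff_left)

lemma Bessel_inequality: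
  assumes "orthonormal_on I e" "finite I"
  shows "(\<Sum>i\<in>I. (cmod (cinner x (e i)))\<^sup>2) \<le> (norm x)\<^sup>2"
proof -
  let ?p = "\<Sum>i\<in>I. cinner x (e i) *\<^sub>C e i"
  have "cinner (x - ?p) ?p = 0"
    by (subst cinner_sum_right) (simp add: cinner_scaleC_right orthonormal_residual [OF assms])
  from norm_add_orthogonal [OF this] show ?thesis
    by (simp add: norm_orthonormal_sum [OF assms])
qed

text \<open>One Gram-Schmidt step per vector.\<close>

lemma finite_orthonormal_annihilator:
  fixes F :: "'a::complex_inner set"
  assumes "finite F"
  obtains B where "finite B" "orthonormal_on B (\<lambda>b. b)"
    "\<And>x f. (\<And>b. b \<in> B \<Longrightarrow> cinner x b = 0) \<Longrightarrow> f \<in> F \<Longrightarrow> cinner x f = 0"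
  using assms
proof (induction F arbitrary: thesis)
  case empty
  then show ?case using empty [of "{}"] by (simp add: orthonormal_on_def)
next
  case (insert f F)
  obtain B where B: "finite B" "orthonormal_on B (\<lambda>b. b)"
    and ann: "\<And>x f. (\<And>b. b \<in> B \<Longrightarrow> cinner x b = 0) \<Longrightarrow> f \<in> F \<Longrightarrow> cinner x f = 0"
    using insert.IH by metis
  define g where "g = f - (\<Sum>b\<in>B. cinner f b *\<^sub>C b)"
  have g: "cinner g b = 0" "cinner b g = 0" if "b \<in> B" for b
  proof -
    show "cinner g b = 0" unfolding g_def by (rule orthonormal_residual [OF B(2,1) that])
    then show "cinner b g = 0" by (metis cinner_commute complex_cnj_zero)
  qed
  have f: "cinner x f = cinner x g" if "\<And>b. b \<in> B \<Longrightarrow> cinner x b = 0" for x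
    using that by (simp add: g_def cinner_simps)
  show ?case
  proof (cases "g = 0")
    case True
    show ?thesis by (rule insert.prems [OF B]) (use ann f True in auto)
  next
    case False
    define h where "h = complex_of_real (inverse (norm g)) *\<^sub>C g"
    have "norm h = 1" using False by (simp add: h_def norm_scaleC norm_inverse)
    then have hh: "cinner h h = 1" by (simp add: cinner_self)
    have hb: "cinner h b = 0" "cinner b h = 0" if "b \<in> B" for b
      using g [OF that] by (simp_all add: h_def cinner_simps)
    have xg: "cinner x g = 0" if "cinner x h = 0" for x
      using that False by (simp add: h_def cinner_simps)
    show ?thesis
    proof (rule insert.prems [of "insert h B"])
      show "orthonormal_on (insert h B) (\<lambda>b. b)"
        using B(2) hh hb by (auto simp: orthonormal_on_def)
      show "cinner x f' = 0" if "\<And>b. b \<in> insert h B \<Longrightarrow> cinner x b = 0" "f' \<in> insert f F" for x f'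
        using that ann f xg by auto
    qed (use B in simp)
  qed
qed

section \<open>Operators bounded below, and bounded below up to finite dimension\<close>

definition bounded_below :: "('a::complex_inner \<Rightarrow> 'a) \<Rightarrow> bool"
  where "bounded_below A \<longleftrightarrow> (\<exists>d>0. \<forall>x. d * norm x \<le> norm (A x))"

text \<open>The negation says that \<open>A\<close> has approximate null vectors orthogonal to any finite set, which is
  Weyl's description of \<open>0\<close> lying in the left essential spectrum; equivalently, \<open>A\<close> fails to have a
  closed range together with a finite-dimensional kernel.\<close>

definition ess_bounded_below :: "('a::complex_inner \<Rightarrow> 'a) \<Rightarrow> bool"
  where "ess_bounded_below A \<longleftrightarrow> (\<exists>F d. finite F \<and> d > 0 \<and>
    (\<forall>x. (\<forall>f\<in>F. cinner x f = 0) \<longrightarrow> d * norm x \<le> norm (A x)))"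

lemma bounded_below_eq_0D: "bounded_below A \<Longrightarrow> A x = 0 \<Longrightarrow> x = 0"
  unfolding bounded_below_def by (metis mult_le_0_iff norm_le_zero_iff norm_zero not_le)

lemma C_symmetric_bounded_below_surj:
  fixes A :: "'a::complex_hilbert_space \<Rightarrow> 'a"
  assumes C: "conjugation C" and A: "C_symmetric C A" and bb: "bounded_below A"
  shows "surj A"
proof (rule ccontr)
  have lin: "bounded_clinear A" using A by (simp add: C_symmetric_def)
  interpret bounded_linear A by (rule bounded_clinear_bounded_linear [OF lin])
  obtain d where d: "d > 0" "\<And>x. d * norm x \<le> norm (A x)" using bb by (auto simp: bounded_below_def)
  have "complete (A ` UNIV)"
    using complete_isometric_image [OF d(1) subspace_UNIV bounded_linear_axioms] d(2) complete_UNIV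
    by blast
  then have closed: "closed (range A)" by (rule complete_imp_closed)
  assume "\<not> surj A"
  then obtain p where p: "p \<notin> range A" by auto
  have "0 \<in> range A" by (metis zero rangeI)
  moreover have "x + y \<in> range A" if "x \<in> range A" "y \<in> range A" for x y
    using that by (auto simp flip: add)
  moreover have "c *\<^sub>C x \<in> range A" if "x \<in> range A" for c x
    using that by (auto simp flip: bounded_clinear_scaleC [OF lin])
  ultimately obtain u where u: "u \<noteq> 0" and orth: "\<And>x. x \<in> range A \<Longrightarrow> cinner u x = 0"
    by (rule closed_subspace_orthogonal_vector [OF closed _ _ _ p]) blast+
  \<comment> \<open>A vector orthogonal to the range is mapped by \<open>C\<close> into the kernel.\<close>
  have "cinner x (C (A (C u))) = 0" for x
    using C_symmetric_cinner [OF C A, of x u] orth [of "A x"] cinner_commute [of "A x" u] by simp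
  then have "C (A (C u)) = 0" using cinner_eq_zero_iff by blast
  then have "A (C u) = 0" by (metis norm_conjugation [OF C] norm_eq_zero)
  then have "C u = 0" by (rule bounded_below_eq_0D [OF bb])
  then show False using u by (metis norm_conjugation [OF C] norm_eq_zero)
qed

lemma C_symmetric_bounded_below_inverse:
  fixes A :: "'a::complex_hilbert_space \<Rightarrow> 'a"
  assumes C: "conjugation C" and A: "C_symmetric C A"
    and d: "d > 0" "\<And>x. d * norm x \<le> norm (A x)"
  obtains S where "bounded_clinear S" "\<And>x. S (A x) = x" "\<And>x. A (S x) = x"
    "\<And>x. norm (S x) \<le> norm x * inverse d"
proof -
  have lin: "bounded_clinear A" using A by (simp add: C_symmetric_def)
  have bb: "bounded_below A" using d by (auto simp: bounded_below_def)
  have surj: "surj A" by (rule C_symmetric_bounded_below_surj [OF C A bb])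
  have inj: "inj A"
  proof (rule injI)
    fix x y assume "A x = A y"
    then have "A (x - y) = 0" using bounded_clinear_diff [OF lin, of x y] by simp
    then have "x - y = 0" by (rule bounded_below_eq_0D [OF bb])
    then show "x = y" by simp
  qed
  have AS: "A (inv A y) = y" for y using surj by (rule surj_f_inv_f)
  have bound: "norm (inv A x) \<le> norm x * inverse d" for x
    using d(2) [of "inv A x", unfolded AS] d(1) by (simp add: field_simps)
  have "bounded_clinear (inv A)"
  proof (rule bounded_clinearI [OF _ _ bound])
    show "inv A (x + y) = inv A x + inv A y" for x y
      by (rule inv_f_eq [OF inj]) (unfold bounded_clinear_add [OF lin] AS, rule refl)
    show "inv A (c *\<^sub>C x) = c *\<^sub>C inv A x" for c x
      by (rule inv_f_eq [OF inj]) (unfold bounded_clinear_scaleC [OF lin] AS, rule refl)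
  qed
  then show thesis using that AS bound inv_f_f [OF inj] by blast
qed

text \<open>For \<open>C\<close>-symmetric operators there is no residual spectrum: \<open>C\<close> carries the orthogonal
  complement of the range onto the kernel.\<close>

lemma C_symmetric_spectrum_iff:
  fixes A :: "'a::complex_hilbert_space \<Rightarrow> 'a"
  assumes C: "conjugation C" and A: "C_symmetric C A"
  shows "z \<in> spectrum A \<longleftrightarrow> \<not> bounded_below (\<lambda>x. A x - z *\<^sub>C x)"
proof -
  let ?B = "\<lambda>x. A x - z *\<^sub>C x"
  have B: "C_symmetric C ?B" by (rule C_symmetric_shift [OF C A])
  have "z \<notin> spectrum A" if "bounded_below ?B"
  proof -
    obtain d where d: "d > 0" "\<And>x. d * norm x \<le> norm (?B x)"
      using \<open>bounded_below ?B\<close> by (auto simp: bounded_below_def)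
    obtain S where S: "bounded_clinear S" "\<And>x. S (?B x) = x" "\<And>x. ?B (S x) = x"
      using C_symmetric_bounded_below_inverse [OF C B d] by metis
    then have "S \<circ> ?B = id" "?B \<circ> S = id" by (simp_all add: fun_eq_iff)
    then show ?thesis using S(1) unfolding spectrum_def by blast
  qed
  moreover have "bounded_below ?B" if z: "z \<notin> spectrum A"
  proof -
    obtain S where S: "bounded_clinear S" "S \<circ> ?B = id" using z unfolding spectrum_def by blast
    obtain M where M: "M > 0" "\<And>x. norm (S x) \<le> M * norm x" using bounded_clinear_bound [OF S(1)] by blast
    have "inverse M * norm x \<le> norm (?B x)" for x
      using M(2) [of "?B x"] fun_cong [OF S(2), of x] M(1) by (simp add: field_simps)
    then show ?thesis unfolding bounded_below_def using M(1) by (metis positive_imp_inverse_positive)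
  qed
  ultimately show ?thesis by blast
qed

lemma norm_shift_change: "norm (A x - w *\<^sub>C x) \<ge> norm (A x - z *\<^sub>C x) - cmod (w - z) * norm x"
  for A :: "'a::complex_inner \<Rightarrow> 'a"
proof -
  have "A x - w *\<^sub>C x = (A x - z *\<^sub>C x) - (w - z) *\<^sub>C x"
    by (simp add: complex_scaling.scale_left_diff_distrib)
  then show ?thesis by (metis norm_scaleC norm_triangle_ineq2)
qed

lemma closed_spectrum_C_symmetric:
  fixes A :: "'a::complex_hilbert_space \<Rightarrow> 'a"
  assumes C: "conjugation C" and A: "C_symmetric C A"
  shows "closed (spectrum A)"
proof -
  have "open (- spectrum A)"
    unfolding open_contains_ball
  proof
    fix z assume "z \<in> - spectrum A"
    then have "bounded_below (\<lambda>x. A x - z *\<^sub>C x)" by (simp add: C_symmetric_spectrum_iff [OF C A])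
    then obtain d where d: "d > 0" "\<And>x. d * norm x \<le> norm (A x - z *\<^sub>C x)"
      by (auto simp: bounded_below_def)
    have "w \<notin> spectrum A" if "w \<in> ball z d" for w
    proof -
      have "cmod (w - z) < d" using that by (simp add: dist_norm norm_minus_commute)
      moreover have "(d - cmod (w - z)) * norm x \<le> norm (A x - w *\<^sub>C x)" for x
        using d(2) [of x] norm_shift_change [of A x z w] by (simp add: algebra_simps)
      ultimately have "bounded_below (\<lambda>x. A x - w *\<^sub>C x)"
        unfolding bounded_below_def by (intro exI [of _ "d - cmod (w - z)"]) auto
      then show ?thesis by (simp add: C_symmetric_spectrum_iff [OF C A])
    qed
    then show "\<exists>e>0. ball z e \<subseteq> - spectrum A" using d(1) by blast
  qed
  then show ?thesis by (simp add: closed_def)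
qed

lemma bounded_spectrum_C_symmetric:
  fixes A :: "'a::complex_hilbert_space \<Rightarrow> 'a"
  assumes C: "conjugation C" and A: "C_symmetric C A"
  shows "bounded (spectrum A)"
proof -
  have "bounded_clinear A" using A by (simp add: C_symmetric_def)
  then obtain M where M: "\<And>x. norm (A x) \<le> M * norm x" using bounded_clinear_bound by blast
  have "cmod z \<le> M" if "z \<in> spectrum A" for z
  proof (rule ccontr)
    assume "\<not> cmod z \<le> M"
    moreover have "(cmod z - M) * norm x \<le> norm (A x - z *\<^sub>C x)" for x
      using M [of x] norm_triangle_ineq3 [of "z *\<^sub>C x" "A x"]
      by (simp add: norm_scaleC algebra_simps norm_minus_commute)
    ultimately have "bounded_below (\<lambda>x. A x - z *\<^sub>C x)"
      unfolding bounded_below_def by (intro exI [of _ "cmod z - M"]) auto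
    then show False using that by (simp add: C_symmetric_spectrum_iff [OF C A])
  qed
  then show ?thesis by (rule boundedI)
qed

text \<open>Splitting off the projection onto the span of the exceptional vectors turns the lower bound on
  their complement into an estimate valid for all vectors.\<close>

lemma ess_bounded_below_a_priori:
  assumes A: "bounded_clinear A" and ess: "ess_bounded_below A"
  obtains B c where "finite B" "c > 0"
    "\<And>x. norm x \<le> c * (norm (A x) + (\<Sum>b\<in>B. cmod (cinner x b)))"
proof -
  obtain F d where F: "finite F" and d: "d > 0"
    and low: "\<And>x. (\<forall>f\<in>F. cinner x f = 0) \<Longrightarrow> d * norm x \<le> norm (A x)"
    using ess unfolding ess_bounded_below_def by blast
  obtain B where B: "finite B" "orthonormal_on B (\<lambda>b. b)"
    and ann: "\<And>x f. (\<And>b. b \<in> B \<Longrightarrow> cinner x b = 0) \<Longrightarrow> f \<in> F \<Longrightarrow> cinner x f = 0"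
    using finite_orthonormal_annihilator [OF F] by metis
  obtain M where M: "M > 0" "\<And>x. norm (A x) \<le> M * norm x" using bounded_clinear_bound [OF A] by blast
  define c where "c = 1 / d * max 1 (d + M)"
  have "norm x \<le> c * (norm (A x) + (\<Sum>b\<in>B. cmod (cinner x b)))" for x
  proof -
    define p where "p = (\<Sum>b\<in>B. cinner x b *\<^sub>C b)"
    define s where "s = (\<Sum>b\<in>B. cmod (cinner x b))"
    have "norm p \<le> s"
      unfolding p_def s_def by (rule sum_norm_le) (simp add: norm_scaleC orthonormal_norm [OF B(2)])
    have "d * norm (x - p) \<le> norm (A (x - p))"
      using ann orthonormal_residual [OF B(2,1)] by (intro low) (auto simp: p_def)
    also have "\<dots> \<le> norm (A x) + norm (A p)"
      unfolding bounded_clinear_diff [OF A] by (rule norm_triangle_ineq4)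
    finally have "d * norm x \<le> norm (A x) + M * norm p + d * norm p"
      using M(2) [of p] d norm_triangle_ineq [of "x - p" p]
      by (smt (verit, best) diff_add_cancel distrib_left mult_left_mono)
    also have "\<dots> \<le> norm (A x) + (d + M) * s"
      using \<open>norm p \<le> s\<close> d M(1) mult_left_mono [of "norm p" s "d + M"] by (simp add: algebra_simps)
    also have "\<dots> \<le> max 1 (d + M) * (norm (A x) + s)"
      unfolding distrib_left
      by (intro add_mono mult_right_mono) (auto simp: s_def sum_nonneg mult_le_cancel_right1)
    finally show ?thesis using d by (simp add: c_def s_def field_simps)
  qed
  moreover have "c > 0" using d by (simp add: c_def)
  ultimately show thesis using that B(1) by blast
qed

lemma finite_family_convergent_subsequence:
  fixes a :: "nat \<Rightarrow> 'b \<Rightarrow> complex"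
  assumes "finite B" "\<And>b. b \<in> B \<Longrightarrow> bounded (range (\<lambda>n. a n b))"
  obtains r :: "nat \<Rightarrow> nat" where "strict_mono r" "\<And>b. b \<in> B \<Longrightarrow> convergent (\<lambda>n. a (r n) b)"
  using assms
proof (induction B arbitrary: thesis)
  case empty
  then show ?case using empty(1) [of id] by (simp add: strict_mono_def)
next
  case (insert b B)
  obtain r :: "nat \<Rightarrow> nat" where r: "strict_mono r" "\<And>b. b \<in> B \<Longrightarrow> convergent (\<lambda>n. a (r n) b)"
    using insert.IH insert.prems(2) by (metis insertI2)
  have "bounded (range (\<lambda>n. a (r n) b))"
    by (rule bounded_subset [OF insert.prems(2) [of b]]) auto
  then obtain l s where s: "strict_mono (s :: nat \<Rightarrow> nat)" "((\<lambda>n. a (r n) b) \<circ> s) \<longlonglongrightarrow> l"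
    using bounded_imp_convergent_subsequence by blast
  show ?case
  proof (rule insert.prems(1) [of "r \<circ> s"])
    show "strict_mono (r \<circ> s)" using r(1) s(1) by (rule strict_mono_o)
    show "convergent (\<lambda>n. a ((r \<circ> s) n) b')" if "b' \<in> insert b B" for b'
    proof (cases "b' = b")
      case True
      then show ?thesis using s(2) by (auto simp: convergent_def o_def)
    next
      case False
      then have "convergent ((\<lambda>n. a (r n) b') \<circ> s)"
        using that by (intro convergent_subseq_convergent r s) auto
      then show ?thesis by (simp add: o_def)
    qed
  qed
qed

text \<open>Up to finitely many coordinates, which converge along a subsequence, the norm is controlled
  by \<open>A\<close>; so normalized vectors with \<open>A x \<rightarrow> 0\<close> would subconverge to a unit vector in the kernel.\<close>

lemma ess_bounded_below_injective:
  fixes A :: "'a::complex_hilbert_space \<Rightarrow> 'a"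
  assumes A: "bounded_clinear A" and ess: "ess_bounded_below A"
    and inj: "\<And>x. A x = 0 \<Longrightarrow> x = 0"
  shows "bounded_below A"
proof (rule ccontr)
  assume not_bb: "\<not> bounded_below A"
  obtain B c where B: "finite B" and c: "c > 0"
    and est: "\<And>x. norm x \<le> c * (norm (A x) + (\<Sum>b\<in>B. cmod (cinner x b)))"
    using ess_bounded_below_a_priori [OF A ess] by blast
  have "\<exists>x. norm x = 1 \<and> norm (A x) < 1 / Suc n" for n
  proof -
    obtain x where x: "norm (A x) < 1 / Suc n * norm x"
      using not_bb unfolding bounded_below_def not_ex not_le
      by (metis linorder_not_le of_nat_0_less_iff zero_less_Suc zero_less_divide_1_iff)
    then have "x \<noteq> 0" by (auto simp: bounded_clinear_zero [OF A])
    then show ?thesis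
      using x by (intro exI [of _ "complex_of_real (inverse (norm x)) *\<^sub>C x"])
        (simp add: bounded_clinear_scaleC [OF A] norm_scaleC norm_divide field_simps)
  qed
  then obtain X where X: "\<And>n. norm (X n) = 1" and AX: "\<And>n. norm (A (X n)) < 1 / Suc n" by metis
  have "bounded (range (\<lambda>n. cinner (X n) b))" for b
    using norm_cinner_le [of "X _" b] X by (auto intro!: boundedI [where B = "norm b"])
  then obtain r where r: "strict_mono r" and conv: "\<And>b. b \<in> B \<Longrightarrow> convergent (\<lambda>n. cinner (X (r n)) b)"
    using finite_family_convergent_subsequence [OF B, of "\<lambda>n b. cinner (X n) b"] by metis
  define Y where "Y n = X (r n)" for n
  have "(\<lambda>n. norm (A (X n))) \<longlonglongrightarrow> 0"
    by (rule Lim_null_comparison [OF _ LIMSEQ_inverse_real_of_nat])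
      (use AX in \<open>auto intro!: always_eventually simp: less_imp_le inverse_eq_divide\<close>)
  then have AY: "(\<lambda>n. A (Y n)) \<longlonglongrightarrow> 0"
    using LIMSEQ_subseq_LIMSEQ [OF _ r] unfolding Y_def by (fastforce simp: o_def tendsto_norm_zero_iff)
  have "Cauchy Y"
  proof (rule metric_CauchyI)
    fix e :: real assume e: "e > 0"
    define X where "X = c * (1 + real (card B))"
    have X: "X > 0" using c by (simp add: X_def add_pos_nonneg)
    define \<delta> where "\<delta> = e / X / 2"
    have \<delta>: "\<delta> > 0" using e X by (simp add: \<delta>_def)
    have "\<exists>N. \<forall>m\<ge>N. \<forall>n\<ge>N. dist (A (Y m)) (A (Y n)) < \<delta>"
      using metric_CauchyD [OF LIMSEQ_imp_Cauchy [OF AY] \<delta>] .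
    moreover have "\<exists>N. \<forall>m\<ge>N. \<forall>n\<ge>N. dist (cinner (Y m) b) (cinner (Y n) b) < \<delta>" if "b \<in> B" for b
      using metric_CauchyD [OF convergent_Cauchy [OF conv [OF that]] \<delta>] by (simp add: Y_def)
    ultimately obtain N0 N where N0: "\<forall>m\<ge>N0. \<forall>n\<ge>N0. dist (A (Y m)) (A (Y n)) < \<delta>"
      and N: "\<And>b. b \<in> B \<Longrightarrow> \<forall>m\<ge>N b. \<forall>n\<ge>N b. dist (cinner (Y m) b) (cinner (Y n) b) < \<delta>"
      by metis
    define K where "K = Max (insert N0 (N ` B))"
    have K: "N0 \<le> K" "\<And>b. b \<in> B \<Longrightarrow> N b \<le> K" using B by (auto simp: K_def)
    have "dist (Y m) (Y n) < e" if mn: "m \<ge> K" "n \<ge> K" for m n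
    proof -
      have "norm (A (Y m - Y n)) \<le> \<delta>"
        using N0 K(1) mn by (auto simp: bounded_clinear_diff [OF A] dist_norm less_imp_le)
      moreover have "(\<Sum>b\<in>B. cmod (cinner (Y m - Y n) b)) \<le> (\<Sum>b\<in>B. \<delta>)"
      proof (rule sum_mono)
        fix b assume b: "b \<in> B"
        then show "cmod (cinner (Y m - Y n) b) \<le> \<delta>"
          using N [OF b] K(2) [OF b] mn by (auto simp: cinner_diff_left dist_norm less_imp_le)
      qed
      ultimately have "norm (Y m - Y n) \<le> c * (\<delta> + card B * \<delta>)"
        using est [of "Y m - Y n"] c
        by (intro order_trans [OF est] mult_left_mono) auto
      also have "\<dots> = X * \<delta>" by (simp add: X_def algebra_simps)
      also have "\<dots> = e / 2" using X by (simp add: \<delta>_def)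
      finally show ?thesis using e by (simp add: dist_norm)
    qed
    then show "\<exists>N. \<forall>m\<ge>N. \<forall>n\<ge>N. dist (Y m) (Y n) < e" by blast
  qed
  then obtain y where y: "Y \<longlonglongrightarrow> y" by (metis Cauchy_convergent_iff convergent_def)
  have "(\<lambda>n. norm (Y n)) \<longlonglongrightarrow> norm y" by (intro tendsto_intros y)
  then have "norm y = 1" by (simp add: Y_def X LIMSEQ_const_iff)
  moreover have "(\<lambda>n. A (Y n)) \<longlonglongrightarrow> A y"
    by (rule bounded_linear.tendsto [OF bounded_clinear_bounded_linear [OF A] y])
  then have "A y = 0" using AY LIMSEQ_unique by blast
  ultimately show False using inj by force
qed

text \<open>The number of orthonormal vectors in the kernel is bounded: each of them has a definite
  component along the finitely many exceptional directions, and Bessel's inequality limits the sum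
  of these components. So a maximal orthonormal subset of the kernel exists.\<close>

lemma ess_bounded_below_kernel_basis:
  fixes A :: "'a::complex_inner \<Rightarrow> 'a"
  assumes A: "bounded_clinear A" and ess: "ess_bounded_below A"
  obtains N where "finite N" "orthonormal_on N (\<lambda>b. b)" "\<And>b. b \<in> N \<Longrightarrow> A b = 0"
    "\<And>x. A x = 0 \<Longrightarrow> (\<And>b. b \<in> N \<Longrightarrow> cinner x b = 0) \<Longrightarrow> x = 0"
proof -
  obtain B c where B: "finite B" and c: "c > 0"
    and est: "\<And>x. norm x \<le> c * (norm (A x) + (\<Sum>b\<in>B. cmod (cinner x b)))"
    using ess_bounded_below_a_priori [OF A ess] by blast
  define good where "good N \<longleftrightarrow> finite N \<and> orthonormal_on N (\<lambda>b. b) \<and> (\<forall>b\<in>N. A b = 0)" for N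
  define R where "R = c\<^sup>2 * card B * (\<Sum>b\<in>B. (norm b)\<^sup>2)"
  have bound: "card N \<le> R" if "good N" for N
  proof -
    from that have fin: "finite N" and on: "orthonormal_on N (\<lambda>b. b)" and ker: "\<And>b. b \<in> N \<Longrightarrow> A b = 0"
      by (auto simp: good_def)
    have one: "1 \<le> c\<^sup>2 * (card B * (\<Sum>b\<in>B. (cmod (cinner b n))\<^sup>2))" if "n \<in> N" for n
    proof -
      have sym: "cmod (cinner n b) = cmod (cinner b n)" for b
        by (metis cinner_commute complex_mod_cnj)
      have "1 \<le> c * (\<Sum>b\<in>B. cmod (cinner b n))"
        using est [of n] ker [OF that] orthonormal_norm [OF on that] by (simp add: sym)
      then have "1\<^sup>2 \<le> (c * (\<Sum>b\<in>B. cmod (cinner b n)))\<^sup>2" by (intro power_mono) auto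
      also have "\<dots> \<le> c\<^sup>2 * (card B * (\<Sum>b\<in>B. (cmod (cinner b n))\<^sup>2))"
        unfolding power_mult_distrib
        by (intro mult_left_mono) (use sum_squared_le_sum_of_squares [of "\<lambda>b. cmod (cinner b n)" B] in \<open>auto simp: mult.commute\<close>)
      finally show ?thesis by simp
    qed
    have "real (card N) = (\<Sum>n\<in>N. 1)" by simp
    also have "\<dots> \<le> (\<Sum>n\<in>N. c\<^sup>2 * (card B * (\<Sum>b\<in>B. (cmod (cinner b n))\<^sup>2)))"
      by (rule sum_mono) (rule one)
    also have "\<dots> = c\<^sup>2 * card B * (\<Sum>b\<in>B. \<Sum>n\<in>N. (cmod (cinner b n))\<^sup>2)"
      by (subst sum.swap) (simp add: sum_distrib_left mult.assoc)
    also have "\<dots> \<le> R"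
      unfolding R_def by (intro mult_left_mono sum_mono Bessel_inequality on fin) auto
    finally show ?thesis .
  qed
  have "good {}" by (simp add: good_def orthonormal_on_def)
  moreover have "\<forall>N. good N \<longrightarrow> card N < nat \<lceil>R\<rceil> + 1"
    using bound by (metis le_nat_iff less_Suc_eq_le Suc_eq_plus1 of_nat_le_iff order_trans real_nat_ceiling_ge)
  ultimately obtain N where N: "good N" and max: "\<And>N'. good N' \<Longrightarrow> card N' \<le> card N"
    using ex_has_greatest_nat [of good "{}" card] by metis
  show thesis
  proof
    show "finite N" "orthonormal_on N (\<lambda>b. b)" "\<And>b. b \<in> N \<Longrightarrow> A b = 0"
      using N by (auto simp: good_def)
    fix x assume x: "A x = 0" and orth: "\<And>b. b \<in> N \<Longrightarrow> cinner x b = 0"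
    show "x = 0"
    proof (rule ccontr)
      assume "x \<noteq> 0"
      define h where "h = complex_of_real (inverse (norm x)) *\<^sub>C x"
      have "norm h = 1" using \<open>x \<noteq> 0\<close> by (simp add: h_def norm_scaleC norm_inverse)
      then have hh: "cinner h h = 1" by (simp add: cinner_self)
      have hb: "cinner h b = 0" "cinner b h = 0" if "b \<in> N" for b
        using orth [OF that] cinner_commute [of b x] by (simp_all add: h_def cinner_simps)
      have "A h = 0" by (simp add: h_def bounded_clinear_scaleC [OF A] x)
      then have "good (insert h N)" using N hh hb by (auto simp: good_def orthonormal_on_def)
      moreover have "h \<notin> N" using hb(1) [of h] hh by auto
      ultimately show False using max [of "insert h N"] N by (simp add: good_def)
    qed
  qed
qed

section \<open>The spectrum near a point outside the essential spectrum\<close>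

text \<open>Gaussian elimination over the holomorphic functions: dividing by a pivot that is not identically
  zero is harmless near \<open>\<xi>\<close>, because its zeros are isolated.\<close>

lemma holomorphic_linear_system_dichotomy:
  fixes g :: "'i \<Rightarrow> 'j \<Rightarrow> complex \<Rightarrow> complex"
  assumes "finite J" "finite I" "open U" "connected U" "\<xi> \<in> U"
    and "\<And>i j. i \<in> I \<Longrightarrow> j \<in> J \<Longrightarrow> g i j holomorphic_on U"
  defines "singular z \<equiv> \<exists>\<alpha>. (\<forall>i\<in>I. (\<Sum>j\<in>J. g i j z * \<alpha> j) = 0) \<and> (\<exists>j\<in>J. \<alpha> j \<noteq> 0)"
  shows "(\<forall>\<^sub>F z in at \<xi>. singular z) \<or> (\<forall>\<^sub>F z in at \<xi>. \<not> singular z)"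
  using assms(1,2,6) unfolding singular_def
proof (induction J arbitrary: I g)
  case empty
  then show ?case by simp
next
  case (insert j J)
  show ?case
  proof (cases "\<forall>i\<in>I. \<forall>z\<in>U. g i j z = 0")
    case True
    have "\<exists>\<alpha>. (\<forall>i\<in>I. (\<Sum>k\<in>insert j J. g i k z * \<alpha> k) = 0) \<and> (\<exists>k\<in>insert j J. \<alpha> k \<noteq> 0)"
      if "z \<in> U" for z
    proof (intro exI conjI ballI)
      let ?\<alpha> = "\<lambda>k. if k = j then 1 else 0"
      show "(\<Sum>k\<in>insert j J. g i k z * ?\<alpha> k) = 0" if "i \<in> I" for i
        using True that \<open>z \<in> U\<close> by (intro sum.neutral) auto
      show "\<exists>k\<in>insert j J. ?\<alpha> k \<noteq> (0::complex)" by auto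
    qed
    moreover have "\<forall>\<^sub>F z in at \<xi>. z \<in> U"
      using \<open>open U\<close> \<open>\<xi> \<in> U\<close> by (rule eventually_at_in_open')
    ultimately show ?thesis by (auto elim: eventually_mono)
  next
    case False
    then obtain p \<beta> where p: "p \<in> I" and \<beta>: "\<beta> \<in> U" "g p j \<beta> \<noteq> 0" by auto
    have pivot: "\<forall>\<^sub>F z in at \<xi>. g p j z \<noteq> 0"
      using non_zero_neighbour_alt [of "g p j" U \<xi> \<beta>] insert.prems p \<beta> assms(3-5)
      by (auto elim: eventually_mono)
    define h where "h i k z = g p j z * g i k z - g i j z * g p k z" for i k z
    have IH: "(\<forall>\<^sub>F z in at \<xi>. \<exists>\<alpha>. (\<forall>i\<in>I - {p}. (\<Sum>k\<in>J. h i k z * \<alpha> k) = 0) \<and> (\<exists>k\<in>J. \<alpha> k \<noteq> 0)) \<or>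
      (\<forall>\<^sub>F z in at \<xi>. \<not> (\<exists>\<alpha>. (\<forall>i\<in>I - {p}. (\<Sum>k\<in>J. h i k z * \<alpha> k) = 0) \<and> (\<exists>k\<in>J. \<alpha> k \<noteq> 0)))"
      using insert.prems p by (intro insert.IH) (auto simp: h_def intro!: holomorphic_intros)
    have h_sum: "(\<Sum>k\<in>J. h i k z * \<alpha> k)
        = g p j z * (\<Sum>k\<in>J. g i k z * \<alpha> k) - g i j z * (\<Sum>k\<in>J. g p k z * \<alpha> k)" for i z \<alpha>
      by (simp add: h_def sum_distrib_left sum_subtractf algebra_simps)
    have equiv: "(\<exists>\<alpha>. (\<forall>i\<in>I - {p}. (\<Sum>k\<in>J. h i k z * \<alpha> k) = 0) \<and> (\<exists>k\<in>J. \<alpha> k \<noteq> 0)) \<longleftrightarrow>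
      (\<exists>\<alpha>. (\<forall>i\<in>I. (\<Sum>k\<in>insert j J. g i k z * \<alpha> k) = 0) \<and> (\<exists>k\<in>insert j J. \<alpha> k \<noteq> 0))"
      (is "?H \<longleftrightarrow> ?G") if nz: "g p j z \<noteq> 0" for z
    proof
      assume ?H
      then obtain \<alpha> where \<alpha>: "\<And>i. i \<in> I - {p} \<Longrightarrow> (\<Sum>k\<in>J. h i k z * \<alpha> k) = 0" "\<exists>k\<in>J. \<alpha> k \<noteq> 0"
        by auto
      define \<beta> where "\<beta> = \<alpha>(j := - (\<Sum>k\<in>J. g p k z * \<alpha> k) / g p j z)"
      have split: "(\<Sum>k\<in>insert j J. g i k z * \<beta> k)
          = (\<Sum>k\<in>J. g i k z * \<alpha> k) - g i j z * (\<Sum>k\<in>J. g p k z * \<alpha> k) / g p j z" for i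
      proof -
        have "(\<Sum>k\<in>J. g i k z * \<beta> k) = (\<Sum>k\<in>J. g i k z * \<alpha> k)"
          using insert.hyps by (intro sum.cong) (auto simp: \<beta>_def)
        then show ?thesis using insert.hyps by (simp add: \<beta>_def)
      qed
      have "(\<Sum>k\<in>insert j J. g i k z * \<beta> k) = 0" if "i \<in> I" for i
      proof (cases "i = p")
        case True
        then show ?thesis using nz by (simp add: split)
      next
        case False
        then have "g p j z * (\<Sum>k\<in>J. g i k z * \<alpha> k) = g i j z * (\<Sum>k\<in>J. g p k z * \<alpha> k)"
          using \<alpha>(1) [of i] that by (simp add: h_sum)
        then show ?thesis unfolding split using nz by (simp add: field_simps)
      qed
      moreover have "\<exists>k\<in>insert j J. \<beta> k \<noteq> 0" using \<alpha>(2) insert.hyps by (auto simp: \<beta>_def)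
      ultimately show ?G by blast
    next
      assume ?G
      then obtain \<alpha> where \<alpha>: "\<And>i. i \<in> I \<Longrightarrow> g i j z * \<alpha> j + (\<Sum>k\<in>J. g i k z * \<alpha> k) = 0"
        and nontriv: "\<exists>k\<in>insert j J. \<alpha> k \<noteq> 0"
        using insert.hyps by auto
      have eq: "(\<Sum>k\<in>J. g i k z * \<alpha> k) = - (g i j z * \<alpha> j)" if "i \<in> I" for i
        using \<alpha> [OF that] by (simp add: eq_neg_iff_add_eq_0 add.commute)
      have "(\<Sum>k\<in>J. h i k z * \<alpha> k) = 0" if "i \<in> I - {p}" for i
        using that p by (simp add: h_sum eq)
      moreover have "\<exists>k\<in>J. \<alpha> k \<noteq> 0"
      proof (rule ccontr)
        assume *: "\<not> (\<exists>k\<in>J. \<alpha> k \<noteq> 0)"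
        then have "g p j z * \<alpha> j = 0" using eq [OF p] by simp
        then show False using nz nontriv * by auto
      qed
      ultimately show ?H by blast
    qed
    from IH show ?thesis
    proof (elim disjE)
      assume "\<forall>\<^sub>F z in at \<xi>. \<exists>\<alpha>. (\<forall>i\<in>I - {p}. (\<Sum>k\<in>J. h i k z * \<alpha> k) = 0) \<and> (\<exists>k\<in>J. \<alpha> k \<noteq> 0)"
      with pivot show ?thesis by (intro disjI1, eventually_elim) (use equiv in blast)
    next
      assume "\<forall>\<^sub>F z in at \<xi>. \<not> (\<exists>\<alpha>. (\<forall>i\<in>I - {p}. (\<Sum>k\<in>J. h i k z * \<alpha> k) = 0) \<and> (\<exists>k\<in>J. \<alpha> k \<noteq> 0))"
      with pivot show ?thesis by (intro disjI2, eventually_elim) (use equiv in blast)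
    qed
  qed
qed

text \<open>The resolvent identity gives the difference quotients of a matrix entry of the resolvent.\<close>

lemma resolvent_holomorphic:
  fixes B :: "'a::complex_inner \<Rightarrow> 'a" and S :: "complex \<Rightarrow> 'a \<Rightarrow> 'a"
  assumes S: "\<And>z. z \<in> U \<Longrightarrow> bounded_clinear (S z)"
    and BS: "\<And>z y. z \<in> U \<Longrightarrow> B (S z y) - z *\<^sub>C S z y = y"
    and SB: "\<And>z x. z \<in> U \<Longrightarrow> S z (B x - z *\<^sub>C x) = x"
    and bound: "\<And>z y. z \<in> U \<Longrightarrow> norm (S z y) \<le> norm y * M" and M: "M \<ge> 0"
  shows "(\<lambda>z. cinner (S z u) v) holomorphic_on U"
proof -
  have resolvent: "S z y - S w y = (z - w) *\<^sub>C S z (S w y)" if "z \<in> U" "w \<in> U" for z w y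
  proof -
    have "y = (B (S w y) - z *\<^sub>C S w y) + (z - w) *\<^sub>C S w y"
      using BS [OF that(2), of y] by (simp add: complex_scaling.scale_left_diff_distrib)
    then have "S z y = S z (B (S w y) - z *\<^sub>C S w y) + S z ((z - w) *\<^sub>C S w y)"
      by (metis bounded_clinear_add [OF S [OF that(1)]])
    then show ?thesis using that by (simp add: SB bounded_clinear_scaleC [OF S])
  qed
  have "((\<lambda>z. cinner (S z u) v) has_field_derivative cinner (S w (S w u)) v) (at w within U)"
    if w: "w \<in> U" for w
    unfolding has_field_derivative_iff
  proof (rule Lim_transform_within [OF _ zero_less_one])
    let ?p = "S w u"
    have "((\<lambda>z. cmod (z - w) * (norm ?p * M * M * norm v)) \<longlongrightarrow> cmod (w - w) * (norm ?p * M * M * norm v)) (at w within U)"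
      by (intro tendsto_intros)
    then have lim: "((\<lambda>z. cmod (z - w) * (norm ?p * M * M * norm v)) \<longlongrightarrow> 0) (at w within U)" by simp
    have "\<forall>\<^sub>F z in at w within U. cmod (cinner (S z ?p) v - cinner (S w ?p) v)
        \<le> cmod (z - w) * (norm ?p * M * M * norm v)"
      unfolding eventually_at_filter
    proof (intro always_eventually allI impI)
      fix z assume z: "z \<in> U"
      have "norm (S z (S w ?p)) \<le> norm (S w ?p) * M" by (rule bound [OF z])
      also have "\<dots> \<le> norm ?p * M * M" by (intro mult_right_mono bound w M)
      finally have "norm (S z (S w ?p)) \<le> norm ?p * M * M" .
      then have "cmod (cinner (S z (S w ?p)) v) \<le> norm ?p * M * M * norm v"
        by (rule order_trans [OF norm_cinner_le mult_right_mono]) simp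
      then show "cmod (cinner (S z ?p) v - cinner (S w ?p) v) \<le> cmod (z - w) * (norm ?p * M * M * norm v)"
        unfolding cinner_diff_left [symmetric] resolvent [OF z w] cinner_scaleC_left norm_mult
        by (rule mult_left_mono) simp
    qed
    then have "((\<lambda>z. cinner (S z ?p) v - cinner (S w ?p) v) \<longlongrightarrow> 0) (at w within U)"
      by (rule Lim_null_comparison [OF _ lim])
    then show "((\<lambda>z. cinner (S z ?p) v) \<longlongrightarrow> cinner (S w ?p) v) (at w within U)"
      by (rule Lim_null [THEN iffD2])
    show "cinner (S z ?p) v = (cinner (S z u) v - cinner (S w u) v) / (z - w)"
      if "z \<in> U" "0 < dist z w" "dist z w < 1" for z
      unfolding cinner_diff_left [symmetric] resolvent [OF that(1) w] cinner_scaleC_left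
      using that(2) by simp
  qed
  then show ?thesis by (auto simp: holomorphic_on_def field_differentiable_def)
qed

text \<open>Adding a finite-rank operator that maps the kernel of \<open>A - \<xi>\<close> isometrically onto its image
  under \<open>C\<close> makes \<open>A - z\<close> invertible for all \<open>z\<close> near \<open>\<xi>\<close>. Solving \<open>(A - z) x = 0\<close> thereby becomes a
  finite linear system with holomorphic coefficients.\<close>

lemma spectrum_near_ess_bounded_below:
  fixes A :: "'a::complex_hilbert_space \<Rightarrow> 'a"
  assumes C: "conjugation C" and A: "C_symmetric C A"
    and ess: "ess_bounded_below (\<lambda>x. A x - \<xi> *\<^sub>C x)"
  obtains r where "r > 0" "ball \<xi> r \<inter> spectrum A \<subseteq> {\<xi>} \<or> ball \<xi> r \<subseteq> spectrum A"
proof -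
  let ?A0 = "\<lambda>x. A x - \<xi> *\<^sub>C x"
  have A0: "C_symmetric C ?A0" by (rule C_symmetric_shift [OF C A])
  then have A0_lin: "bounded_clinear ?A0" by (simp add: C_symmetric_def)
  obtain N where N: "finite N" "orthonormal_on N (\<lambda>b. b)" and ker: "\<And>b. b \<in> N \<Longrightarrow> ?A0 b = 0"
    and max: "\<And>x. ?A0 x = 0 \<Longrightarrow> (\<And>b. b \<in> N \<Longrightarrow> cinner x b = 0) \<Longrightarrow> x = 0"
    using ess_bounded_below_kernel_basis [OF A0_lin ess] by metis
  define R where "R x = (\<Sum>b\<in>N. cinner x b *\<^sub>C C b)" for x
  define B where "B x = A x + R x" for x
  have R: "C_symmetric C R"
    unfolding R_def by (intro C_symmetric_finite_sum [OF C] C_symmetric_rank_one [OF C])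
  have B: "C_symmetric C B" unfolding B_def by (rule C_symmetric_add [OF C A R])
  have Bz: "C_symmetric C (\<lambda>x. B x - z *\<^sub>C x)" for z by (rule C_symmetric_shift [OF C B])
  have Bz_eq: "B x - z *\<^sub>C x = (A x - z *\<^sub>C x) + R x" for x z by (simp add: B_def)
  have R0: "R x = 0" if "\<And>b. b \<in> N \<Longrightarrow> cinner x b = 0" for x using that by (simp add: R_def)
  have "bounded_below (\<lambda>x. B x - \<xi> *\<^sub>C x)"
  proof (rule ess_bounded_below_injective)
    show "bounded_clinear (\<lambda>x. B x - \<xi> *\<^sub>C x)" using Bz by (simp add: C_symmetric_def)
    obtain F d where "finite F" "d > 0"
      "\<And>x. (\<forall>f\<in>F. cinner x f = 0) \<Longrightarrow> d * norm x \<le> norm (?A0 x)"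
      using ess unfolding ess_bounded_below_def by blast
    then show "ess_bounded_below (\<lambda>x. B x - \<xi> *\<^sub>C x)"
      unfolding ess_bounded_below_def using N(1) R0
      by (intro exI [of _ "F \<union> N"] exI [of _ d]) (auto simp: Bz_eq)
    fix x assume x: "B x - \<xi> *\<^sub>C x = 0"
    \<comment> \<open>The range of \<open>A - \<xi>\<close> is orthogonal to the range of the finite-rank part.\<close>
    have "cinner (?A0 x) (C b) = 0" if "b \<in> N" for b
    proof -
      have "cinner (?A0 x) (C b) = cinner (?A0 b) (C x)"
        using A0 unfolding C_symmetric_def by blast
      then show ?thesis by (simp only: ker [OF that] cinner_zero_left)
    qed
    moreover have "cinner (R x) (C b) = cinner x b" if "b \<in> N" for b
    proof -
      have "orthonormal_on N C"
        using N(2) unfolding orthonormal_on_def cinner_conjugation [OF C] by metis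
      then show ?thesis unfolding R_def by (rule cinner_orthonormal_sum [OF _ N(1) that])
    qed
    ultimately have orth: "cinner x b = 0" if "b \<in> N" for b
      using arg_cong [OF x, of "\<lambda>y. cinner y (C b)"] that unfolding Bz_eq cinner_add_left by simp
    moreover have "?A0 x = 0" using x R0 [OF orth] by (simp add: Bz_eq)
    ultimately show "x = 0" using max by blast
  qed
  then obtain d where d: "d > 0" "\<And>x. d * norm x \<le> norm (B x - \<xi> *\<^sub>C x)"
    by (auto simp: bounded_below_def)
  define U where "U = ball \<xi> (d / 2)"
  have lower: "d / 2 * norm x \<le> norm (B x - z *\<^sub>C x)" if "z \<in> U" for z x
  proof -
    have "cmod (z - \<xi>) * norm x \<le> d / 2 * norm x"
      using that by (intro mult_right_mono) (auto simp: U_def dist_norm norm_minus_commute)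
    then show ?thesis using d(2) [of x] norm_shift_change [of B x \<xi> z] by (simp add: field_simps)
  qed
  have "\<exists>S. bounded_clinear S \<and> (\<forall>x. S (B x - z *\<^sub>C x) = x) \<and> (\<forall>y. B (S y) - z *\<^sub>C S y = y) \<and>
      (\<forall>y. norm (S y) \<le> norm y * inverse (d / 2))" if "z \<in> U" for z
    using C_symmetric_bounded_below_inverse [OF C Bz, of "d / 2" z] lower [OF that] d(1)
    by (metis half_gt_zero)
  then obtain S where S: "\<And>z. z \<in> U \<Longrightarrow> bounded_clinear (S z)"
    and SB: "\<And>z x. z \<in> U \<Longrightarrow> S z (B x - z *\<^sub>C x) = x"
    and BS: "\<And>z y. z \<in> U \<Longrightarrow> B (S z y) - z *\<^sub>C S z y = y"
    and S_bound: "\<And>z y. z \<in> U \<Longrightarrow> norm (S z y) \<le> norm y * inverse (d / 2)"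
    by metis
  define g where "g a b z = (if a = b then 1 else 0) - cinner (S z (C b)) a" for a b z
  define singular where
    "singular z \<longleftrightarrow> (\<exists>\<alpha>. (\<forall>a\<in>N. (\<Sum>b\<in>N. g a b z * \<alpha> b) = 0) \<and> (\<exists>b\<in>N. \<alpha> b \<noteq> 0))" for z
  have dich: "(\<forall>\<^sub>F z in at \<xi>. singular z) \<or> (\<forall>\<^sub>F z in at \<xi>. \<not> singular z)"
    unfolding singular_def
  proof (rule holomorphic_linear_system_dichotomy [OF N(1) N(1), of U])
    show "g a b holomorphic_on U" for a b
      unfolding g_def using S SB BS S_bound d(1)
      by (intro holomorphic_intros resolvent_holomorphic [where B = B and M = "inverse (d / 2)"]) auto
  qed (use d(1) in \<open>auto simp: U_def\<close>)
  have row: "(\<Sum>b\<in>N. g a b z * \<alpha> b) = \<alpha> a - cinner (S z (\<Sum>b\<in>N. \<alpha> b *\<^sub>C C b)) a"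
    if "z \<in> U" "a \<in> N" for z a \<alpha>
  proof -
    have "(\<Sum>b\<in>N. (if a = b then 1 else 0) * \<alpha> b) = \<alpha> a"
      using N(1) that(2) by (simp add: if_distrib [of "\<lambda>t. t * _"] cong: if_cong)
    then show ?thesis
      by (simp add: g_def bounded_clinear_simps [OF S [OF that(1)]] cinner_simps left_diff_distrib
          right_diff_distrib
          sum_subtractf mult.commute)
  qed
  have iff: "z \<in> spectrum A \<longleftrightarrow> singular z" if z: "z \<in> U" for z
  proof
    assume "singular z"
    then obtain \<alpha> b where sys: "\<And>a. a \<in> N \<Longrightarrow> (\<Sum>b\<in>N. g a b z * \<alpha> b) = 0" and b: "b \<in> N" "\<alpha> b \<noteq> 0"
      unfolding singular_def by blast
    define x where "x = S z (\<Sum>b\<in>N. \<alpha> b *\<^sub>C C b)"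
    have coord: "cinner x a = \<alpha> a" if "a \<in> N" for a
      using sys [OF that] row [OF z that, of \<alpha>] by (simp add: x_def)
    have "B x - z *\<^sub>C x = (\<Sum>b\<in>N. \<alpha> b *\<^sub>C C b)" unfolding x_def by (rule BS [OF z])
    also have "\<dots> = R x" unfolding R_def by (intro sum.cong) (simp_all add: coord)
    finally have "A x - z *\<^sub>C x = 0" by (simp add: Bz_eq)
    moreover have "x \<noteq> 0" using coord [OF b(1)] b(2) by auto
    ultimately show "z \<in> spectrum A"
      using bounded_below_eq_0D [of "\<lambda>x. A x - z *\<^sub>C x" x] by (auto simp: C_symmetric_spectrum_iff [OF C A])
  next
    assume spec: "z \<in> spectrum A"
    have lin: "bounded_clinear (\<lambda>x. A x - z *\<^sub>C x)"
      using A by (simp add: C_symmetric_def bounded_clinear_shift)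
    have "ess_bounded_below (\<lambda>x. A x - z *\<^sub>C x)"
      unfolding ess_bounded_below_def
    proof (intro exI conjI allI impI)
      fix x assume "\<forall>b\<in>N. cinner x b = 0"
      then show "d / 2 * norm x \<le> norm (A x - z *\<^sub>C x)"
        using lower [OF z, of x] R0 [of x] by (simp add: Bz_eq)
    qed (use N(1) d(1) in simp_all)
    then obtain x where x: "A x - z *\<^sub>C x = 0" "x \<noteq> 0"
      using ess_bounded_below_injective [OF lin] spec by (auto simp: C_symmetric_spectrum_iff [OF C A])
    have xR: "x = S z (R x)" using SB [OF z, of x] x(1) by (simp add: Bz_eq)
    have "(\<Sum>b\<in>N. g a b z * cinner x b) = 0" if "a \<in> N" for a
      unfolding row [OF z that] R_def [symmetric] xR [symmetric] by simp
    moreover have "\<exists>b\<in>N. cinner x b \<noteq> 0"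
    proof (rule ccontr)
      assume "\<not> ?thesis"
      then have "R x = 0" by (intro R0) auto
      then show False using xR x(2) by (simp add: bounded_clinear_zero [OF S [OF z]])
    qed
    ultimately show "singular z" unfolding singular_def by blast
  qed
  have U: "\<forall>\<^sub>F z in at \<xi>. z \<in> U"
    by (rule eventually_at_in_open') (use d(1) in \<open>auto simp: U_def\<close>)
  from dich show thesis
  proof
    assume "\<forall>\<^sub>F z in at \<xi>. \<not> singular z"
    with U have "\<forall>\<^sub>F z in at \<xi>. z \<notin> spectrum A" by eventually_elim (use iff in blast)
    then obtain r where "r > 0" "\<And>z. z \<noteq> \<xi> \<Longrightarrow> dist z \<xi> < r \<Longrightarrow> z \<notin> spectrum A"
      by (auto simp: eventually_at)
    then have "ball \<xi> r \<inter> spectrum A \<subseteq> {\<xi>}" by (fastforce simp: dist_commute)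
    then show thesis using that \<open>r > 0\<close> by blast
  next
    assume "\<forall>\<^sub>F z in at \<xi>. singular z"
    with U have ev: "\<forall>\<^sub>F z in at \<xi>. z \<in> spectrum A" by eventually_elim (use iff in blast)
    moreover have "\<xi> \<in> spectrum A"
      by (rule Lim_in_closed_set [OF closed_spectrum_C_symmetric [OF C A] ev _ tendsto_ident_at]) simp
    moreover obtain r where r: "r > 0" "\<And>z. z \<noteq> \<xi> \<Longrightarrow> dist z \<xi> < r \<Longrightarrow> z \<in> spectrum A"
      using ev by (auto simp: eventually_at)
    ultimately have "ball \<xi> r \<subseteq> spectrum A" by (metis dist_commute mem_ball subsetI)
    then show thesis using that r(1) by blast
  qed
qed

section \<open>Diagonal operators\<close>

instance complex_hilbert_space \<subseteq> banach ..

definition diagonal :: "(nat \<Rightarrow> 'a::complex_hilbert_space) \<Rightarrow> (nat \<Rightarrow> complex) \<Rightarrow> 'a \<Rightarrow> 'a"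
  where "diagonal e a x = (\<Sum>n. (a n * cinner x (e n)) *\<^sub>C e n)"

context
  fixes e :: "nat \<Rightarrow> 'a::complex_hilbert_space"
  assumes e: "orthonormal_on UNIV e"
begin

lemma norm_diagonal_partial_sum:
  assumes "\<And>n. cmod (a n) \<le> M" "finite I"
  shows "(norm (\<Sum>n\<in>I. (a n * cinner x (e n)) *\<^sub>C e n))\<^sup>2 \<le> M\<^sup>2 * (\<Sum>n\<in>I. (cmod (cinner x (e n)))\<^sup>2)"
proof -
  have "orthonormal_on I e" using e by (rule orthonormal_on_subset) simp
  then have "(norm (\<Sum>n\<in>I. (a n * cinner x (e n)) *\<^sub>C e n))\<^sup>2 = (\<Sum>n\<in>I. (cmod (a n * cinner x (e n)))\<^sup>2)"
    using assms(2) by (rule norm_orthonormal_sum)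
  also have "\<dots> \<le> (\<Sum>n\<in>I. M\<^sup>2 * (cmod (cinner x (e n)))\<^sup>2)"
    unfolding norm_mult power_mult_distrib
    by (intro sum_mono mult_right_mono power_mono assms) auto
  finally show ?thesis by (simp add: sum_distrib_left)
qed

lemma Bessel_finite: "finite I \<Longrightarrow> (\<Sum>n\<in>I. (cmod (cinner x (e n)))\<^sup>2) \<le> (norm x)\<^sup>2"
  by (rule Bessel_inequality [OF orthonormal_on_subset [OF e]]) auto

lemma summable_diagonal:
  assumes a: "\<And>n. cmod (a n) \<le> M"
  shows "summable (\<lambda>n. (a n * cinner x (e n)) *\<^sub>C e n)"
  unfolding summable_Cauchy
proof (intro allI impI)
  fix \<epsilon> :: real assume \<epsilon>: "\<epsilon> > 0"
  have M: "M \<ge> 0" using a [of 0] norm_ge_zero order_trans by blast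
  define \<delta> where "\<delta> = \<epsilon>\<^sup>2 / (M\<^sup>2 + 1)"
  have "M\<^sup>2 + 1 > 0" by (simp add: add_nonneg_pos)
  then have \<delta>: "\<delta> > 0" "M\<^sup>2 * \<delta> < \<epsilon>\<^sup>2" using \<epsilon> by (simp_all add: \<delta>_def field_simps)
  have "summable (\<lambda>n. (cmod (cinner x (e n)))\<^sup>2)"
    by (rule summableI_nonneg_bounded [where x = "(norm x)\<^sup>2"]) (auto intro: Bessel_finite)
  then obtain N where N: "\<And>m n. m \<ge> N \<Longrightarrow> norm (\<Sum>k=m..<n. (cmod (cinner x (e k)))\<^sup>2) < \<delta>"
    unfolding summable_Cauchy using \<delta>(1) by blast
  have "norm (\<Sum>k=m..<n. (a k * cinner x (e k)) *\<^sub>C e k) < \<epsilon>" if "m \<ge> N" for m n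
  proof -
    have "(\<Sum>k=m..<n. (cmod (cinner x (e k)))\<^sup>2) \<le> \<delta>" using N [OF that, of n] by simp
    then have "(norm (\<Sum>k=m..<n. (a k * cinner x (e k)) *\<^sub>C e k))\<^sup>2 \<le> M\<^sup>2 * \<delta>"
      by (intro order_trans [OF norm_diagonal_partial_sum [OF a]] mult_left_mono) auto
    then have "(norm (\<Sum>k=m..<n. (a k * cinner x (e k)) *\<^sub>C e k))\<^sup>2 < \<epsilon>\<^sup>2" using \<delta>(2) by simp
    then show ?thesis using \<epsilon> by (simp add: power_less_imp_less_base)
  qed
  then show "\<exists>N. \<forall>m\<ge>N. \<forall>n. norm (\<Sum>k=m..<n. (a k * cinner x (e k)) *\<^sub>C e k) < \<epsilon>" by blast
qed

lemma norm_diagonal: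
  assumes a: "\<And>n. cmod (a n) \<le> M"
  shows "norm (diagonal e a x) \<le> norm x * M"
proof -
  have M: "M \<ge> 0" using a [of 0] norm_ge_zero order_trans by blast
  have "norm (\<Sum>k<n. (a k * cinner x (e k)) *\<^sub>C e k) \<le> norm x * M" for n
  proof (rule power2_le_imp_le)
    have "(norm (\<Sum>k<n. (a k * cinner x (e k)) *\<^sub>C e k))\<^sup>2 \<le> M\<^sup>2 * (norm x)\<^sup>2"
      by (intro order_trans [OF norm_diagonal_partial_sum [OF a]] mult_left_mono Bessel_finite) auto
    then show "(norm (\<Sum>k<n. (a k * cinner x (e k)) *\<^sub>C e k))\<^sup>2 \<le> (norm x * M)\<^sup>2"
      by (simp add: power_mult_distrib mult.commute)
  qed (use M in simp)
  moreover have "(\<lambda>n. norm (\<Sum>k<n. (a k * cinner x (e k)) *\<^sub>C e k)) \<longlonglongrightarrow> norm (diagonal e a x)"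
    unfolding diagonal_def by (intro tendsto_norm summable_LIMSEQ summable_diagonal [OF a])
  ultimately show ?thesis by (intro LIMSEQ_le_const2) auto
qed

lemma bounded_linear_diagonal:
  assumes a: "\<And>n. cmod (a n) \<le> M" and F: "bounded_linear F"
  shows "F (diagonal e a x) = (\<Sum>n. F ((a n * cinner x (e n)) *\<^sub>C e n))"
  unfolding diagonal_def by (rule bounded_linear.suminf [OF F summable_diagonal]) (rule a)

lemma bounded_clinear_diagonal:
  assumes a: "\<And>n. cmod (a n) \<le> M"
  shows "bounded_clinear (diagonal e a)"
proof (rule bounded_clinearI)
  show "diagonal e a (x + y) = diagonal e a x + diagonal e a y" for x y
    unfolding diagonal_def suminf_add [OF summable_diagonal [OF a] summable_diagonal [OF a]]
    by (simp add: cinner_simps scaleC_add_left distrib_left)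
  show "diagonal e a (c *\<^sub>C x) = c *\<^sub>C diagonal e a x" for c x
    unfolding bounded_linear_diagonal [OF a bounded_linear_scaleC_right]
    unfolding diagonal_def by (simp add: cinner_simps scaleC_scaleC mult.left_commute)
  show "norm (diagonal e a x) \<le> norm x * M" for x by (rule norm_diagonal [OF a])
qed

lemma diagonal_add:
  assumes "\<And>n. cmod (a n) \<le> M" "\<And>n. cmod (b n) \<le> L"
  shows "diagonal e a x + diagonal e b x = diagonal e (\<lambda>n. a n + b n) x"
  unfolding diagonal_def
  by (simp add: suminf_add summable_diagonal [OF assms(1)] summable_diagonal [OF assms(2)]
      distrib_right scaleC_add_left)

lemma cinner_diagonal:
  assumes a: "\<And>n. cmod (a n) \<le> M"
  shows "cinner (diagonal e a x) (e m) = a m * cinner x (e m)"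
proof -
  have "cinner (diagonal e a x) (e m) = (\<Sum>n. if n = m then a m * cinner x (e m) else 0)"
    unfolding bounded_linear_diagonal [OF a bounded_linear_cinner_left]
    using orthonormal_onD [OF e] by (intro arg_cong [where f = suminf] ext) (auto simp: cinner_simps)
  also have "\<dots> = a m * cinner x (e m)"
    using sums_unique [OF sums_single [of m "\<lambda>_. a m * cinner x (e m)"]] by simp
  finally show ?thesis .
qed

lemma cinner_diagonal_orthogonal:
  assumes a: "\<And>n. cmod (a n) \<le> M" and y: "\<And>n. cinner (e n) y = 0"
  shows "cinner (diagonal e a x) y = 0"
  unfolding bounded_linear_diagonal [OF a bounded_linear_cinner_left] by (simp add: cinner_simps y)

lemma diagonal_diagonal:
  assumes "\<And>n. cmod (b n) \<le> M"
  shows "diagonal e a (diagonal e b x) = diagonal e (\<lambda>n. a n * b n) x"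
  unfolding diagonal_def [of e a] cinner_diagonal [OF assms] by (simp add: diagonal_def mult.assoc)

lemma diagonal_on_eigenvectors:
  assumes a: "\<And>n. cmod (a n) \<le> M"
    and A: "bounded_clinear A" "\<And>n. A (e n) = \<alpha> n *\<^sub>C e n"
  shows "A (diagonal e a x) = diagonal e (\<lambda>n. \<alpha> n * a n) x"
  unfolding bounded_linear_diagonal [OF a bounded_clinear_bounded_linear [OF A(1)]]
  by (simp add: diagonal_def bounded_clinear_scaleC [OF A(1)] A(2) scaleC_scaleC ac_simps)

lemma diagonal_basis:
  assumes a: "\<And>n. cmod (a n) \<le> M"
  shows "diagonal e a (e m) = a m *\<^sub>C e m"
proof -
  have "diagonal e a (e m) = (\<Sum>n. if n = m then a m *\<^sub>C e m else 0)"
    unfolding diagonal_def using orthonormal_onD [OF e]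
    by (intro arg_cong [where f = suminf] ext) auto
  also have "\<dots> = a m *\<^sub>C e m"
    using sums_unique [OF sums_single [of m "\<lambda>_. a m *\<^sub>C e m"]] by simp
  finally show ?thesis .
qed

text \<open>The inverse of \<open>1 + a\<close> on the diagonal is \<open>1 + b\<close> with \<open>a + b + a b = 0\<close>.\<close>

lemma bounded_below_identity_plus_diagonal:
  assumes a: "\<And>n. cmod (a n) \<le> M" and b: "\<And>n. cmod (b n) \<le> L"
    and ab: "\<And>n. a n + b n + b n * a n = 0"
  shows "bounded_below (\<lambda>x. x + diagonal e a x)"
proof -
  have L: "L \<ge> 0" using b [of 0] norm_ge_zero order_trans by blast
  have ba: "cmod (b n * a n) \<le> L * M" for n
    unfolding norm_mult using a [of n] b [of n] L by (intro mult_mono) auto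
  have a_b: "cmod (a n + b n) \<le> M + L" for n
    by (rule norm_triangle_le) (use a [of n] b [of n] in simp)
  have "norm x \<le> (1 + L) * norm (x + diagonal e a x)" for x
  proof -
    let ?y = "x + diagonal e a x"
    have "?y + diagonal e b ?y = x + (diagonal e a x + diagonal e b x + diagonal e (\<lambda>n. b n * a n) x)"
      by (simp add: bounded_clinear_add [OF bounded_clinear_diagonal [OF b]] diagonal_diagonal [OF a])
    also have "\<dots> = x"
      unfolding diagonal_add [OF a b] diagonal_add [OF a_b ba] ab by (simp add: diagonal_def)
    finally have "norm x = norm (?y + diagonal e b ?y)" by (simp only:)
    also have "\<dots> \<le> norm ?y + norm ?y * L"
      by (rule norm_triangle_le) (use norm_diagonal [OF b] in simp)
    finally show ?thesis by (simp add: algebra_simps)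
  qed
  then have "inverse (1 + L) * norm x \<le> norm (x + diagonal e a x)" for x
    using L by (simp add: field_simps)
  then show ?thesis
    unfolding bounded_below_def using L by (intro exI [of _ "inverse (1 + L)"]) auto
qed

end

lemma bounded_below_comp:
  assumes "bounded_below A" "bounded_below B" shows "bounded_below (\<lambda>x. A (B x))"
proof -
  obtain c d where c: "c > 0" "\<And>x. c * norm x \<le> norm (A x)" and d: "d > 0" "\<And>x. d * norm x \<le> norm (B x)"
    using assms by (auto simp: bounded_below_def)
  have "c * d * norm x \<le> norm (A (B x))" for x
    using c(2) [of "B x"] mult_left_mono [OF d(2) [of x], of c] c(1)
    unfolding mult.assoc by linarith
  then show ?thesis unfolding bounded_below_def using c(1) d(1) by (intro exI [of _ "c * d"]) auto
qed

text \<open>Let \<open>e n\<close> be eigenvectors of \<open>X\<close> and \<open>f n\<close> eigenvectors of its adjoint. With respect to the span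
  of the \<open>e n\<close>, the span of the \<open>f n\<close> and the rest of the space, \<open>X\<close> is block triangular with diagonal
  blocks in the two corners. Changing these two blocks amounts to multiplying \<open>X - \<mu>\<close> from the right
  and from the left by diagonal operators.\<close>

lemma bounded_below_change_eigenvalues:
  fixes X :: "'a::complex_hilbert_space \<Rightarrow> 'a"
  assumes X: "bounded_clinear X"
    and e: "orthonormal_on UNIV e" and f: "orthonormal_on UNIV f" and ef: "\<And>m n. cinner (e m) (f n) = 0"
    and Xe: "\<And>n. X (e n) = \<alpha> n *\<^sub>C e n" and Xf: "\<And>x n. cinner (X x) (f n) = \<alpha> n * cinner x (f n)"
    and c: "\<And>n. cmod (c n) \<le> M" and d: "d > 0"
    and gap: "\<And>n. d \<le> cmod (\<alpha> n - \<mu>)" "\<And>n. d \<le> cmod (\<alpha> n + c n - \<mu>)"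
    and bb: "bounded_below (\<lambda>x. X x - \<mu> *\<^sub>C x)"
  shows "bounded_below (\<lambda>x. X x + diagonal e c x + diagonal f c x - \<mu> *\<^sub>C x)"
proof -
  define a where "a n = c n / (\<alpha> n - \<mu>)" for n
  define b where "b n = - c n / (\<alpha> n + c n - \<mu>)" for n
  have nz: "\<alpha> n - \<mu> \<noteq> 0" "\<alpha> n + c n - \<mu> \<noteq> 0" for n using gap [of n] d by auto
  have M: "M \<ge> 0" using c [of 0] norm_ge_zero order_trans by blast
  have a_bound: "cmod (a n) \<le> M / d" for n
    unfolding a_def norm_divide using c [of n] gap(1) [of n] d M by (intro frac_le) auto
  have b_bound: "cmod (b n) \<le> M / d" for n
    unfolding b_def norm_divide norm_minus_cancel using c [of n] gap(2) [of n] d M by (intro frac_le) auto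
  have ab: "a n + b n + b n * a n = 0" for n
    using nz [of n] by (simp add: a_def b_def divide_simps) (simp add: algebra_simps)
  let ?X = "\<lambda>x. X x - \<mu> *\<^sub>C x"
  have lin: "bounded_clinear ?X" by (rule bounded_clinear_shift [OF X])
  have "?X (e n) = (\<alpha> n - \<mu>) *\<^sub>C e n" for n
    by (simp add: Xe complex_scaling.scale_left_diff_distrib)
  from diagonal_on_eigenvectors [where a = a, OF e a_bound lin this]
  have right: "?X (diagonal e a x) = diagonal e c x" for x using nz by (simp add: a_def)
  have "a n * (\<alpha> n * t - \<mu> * t) = c n * t" for n t
    using nz(1) [of n] by (simp add: a_def flip: left_diff_distrib)
  then have left: "diagonal f a (?X x) = diagonal f c x" for x
    unfolding diagonal_def [of f a] cinner_diff_left cinner_scaleC_left Xf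
    by (simp add: diagonal_def)
  have cross: "diagonal f a (diagonal e c x) = 0" for x
    unfolding diagonal_def [of f a] by (simp add: cinner_diagonal_orthogonal [OF e c ef])
  have "X x + diagonal e c x + diagonal f c x - \<mu> *\<^sub>C x
      = ?X (x + diagonal e a x) + diagonal f a (?X (x + diagonal e a x))" for x
    unfolding bounded_clinear_add [OF lin] right
      bounded_clinear_add [OF bounded_clinear_diagonal [OF f a_bound]] left cross
    by simp
  moreover have "bounded_below (\<lambda>x. (\<lambda>y. y + diagonal f a y) (?X (x + diagonal e a x)))"
    by (rule bounded_below_comp [OF _ bounded_below_comp [OF bb]])
      (rule bounded_below_identity_plus_diagonal [OF f a_bound b_bound ab]
        bounded_below_identity_plus_diagonal [OF e a_bound b_bound ab])+
  ultimately show ?thesis by presburger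
qed

section \<open>Approximate eigenvectors\<close>

lemma approximate_eigenvector:
  assumes A: "bounded_clinear A" and not_ess: "\<not> ess_bounded_below A"
    and F: "finite F" and \<delta>: "\<delta> > 0"
  obtains x where "norm x = 1" "\<And>f. f \<in> F \<Longrightarrow> cinner x f = 0" "norm (A x) < \<delta>"
proof -
  obtain y where y: "\<forall>f\<in>F. cinner y f = 0" "norm (A y) < \<delta> * norm y"
    using not_ess F \<delta> unfolding ess_bounded_below_def by (meson not_le)
  have y0: "norm y > 0" using y(2) bounded_clinear_zero [OF A] by fastforce
  show thesis
  proof
    let ?x = "complex_of_real (inverse (norm y)) *\<^sub>C y"
    have n: "cmod (complex_of_real (inverse (norm y))) = inverse (norm y)" by (simp add: norm_inverse)
    show "norm ?x = 1" unfolding norm_scaleC n using y0 by simp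
    show "cinner ?x f = 0" if "f \<in> F" for f using y(1) that by (simp add: cinner_simps)
    show "norm (A ?x) < \<delta>"
      unfolding bounded_clinear_scaleC [OF A] norm_scaleC n using y0 y(2) by (simp add: field_simps)
  qed
qed

text \<open>A symmetric bilinear form on a two-dimensional complex space has an isotropic vector, so
  approximate eigenvectors can be chosen orthogonal to their images under \<open>C\<close>.\<close>

lemma isotropic_approximate_eigenvector:
  assumes C: "conjugation C" and A: "bounded_clinear A" and not_ess: "\<not> ess_bounded_below A"
    and F: "finite F" and \<delta>: "\<delta> > 0"
  obtains x where "norm x = 1" "\<And>f. f \<in> F \<Longrightarrow> cinner x f = 0" "norm (A x) < \<delta>" "cinner x (C x) = 0"
proof -
  obtain u where u: "norm u = 1" "\<And>f. f \<in> F \<Longrightarrow> cinner u f = 0" "norm (A u) < \<delta> / 2"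
    using approximate_eigenvector [OF A not_ess F, of "\<delta> / 2"] \<delta> by auto
  obtain v where v: "norm v = 1" "\<And>f. f \<in> insert u F \<Longrightarrow> cinner v f = 0" "norm (A v) < \<delta> / 2"
    using approximate_eigenvector [OF A not_ess, of "insert u F" "\<delta> / 2"] F \<delta> by auto
  show thesis
  proof (cases "cinner v (C v) = 0")
    case True
    then show thesis using that [of v] v \<delta> by auto
  next
    case False
    define p q s where "p = cinner u (C u)" and "q = cinner u (C v)" and "s = cinner v (C v)"
    \<comment> \<open>The form takes the value \<open>p + 2 t q + t\<^sup>2 s\<close> at \<open>u + t v\<close>.\<close>
    define t where "t = (- q + csqrt (q\<^sup>2 - p * s)) / s"
    have s0: "s \<noteq> 0" using False by (simp add: s_def)
    have "(s * t + q)\<^sup>2 = q\<^sup>2 - p * s" using s0 by (simp add: t_def)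
    then have "s * (p + 2 * t * q + t\<^sup>2 * s) = 0" by algebra
    then have root: "p + 2 * t * q + t\<^sup>2 * s = 0" using s0 by simp
    define w where "w = u + t *\<^sub>C v"
    have "cinner v (C u) = q" unfolding q_def by (rule cinner_conjugation_right [OF C])
    then have "cinner w (C w) = p + 2 * t * q + t\<^sup>2 * s"
      by (simp add: w_def conjugation_add [OF C] conjugation_scaleC [OF C] cinner_simps
          p_def [symmetric] s_def [symmetric] q_def [symmetric] algebra_simps power2_eq_square)
    then have iso: "cinner w (C w) = 0" using root by simp
    have "cinner u v = 0" using v(2) [of u] cinner_commute [of u v] by simp
    then have "(norm w)\<^sup>2 = 1 + (cmod t)\<^sup>2"
      using norm_add_orthogonal [of u "t *\<^sub>C v"] by (simp add: w_def u v norm_scaleC cinner_simps)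
    then have w1: "1 \<le> norm w" "cmod t \<le> norm w"
      by (auto intro: power2_le_imp_le)
    have "norm (A w) \<le> norm (A u) + cmod t * norm (A v)"
      unfolding w_def bounded_clinear_add [OF A] bounded_clinear_scaleC [OF A]
      using norm_triangle_ineq [of "A u" "t *\<^sub>C A v"] by (simp add: norm_scaleC)
    also have "\<dots> < \<delta> / 2 + cmod t * (\<delta> / 2)"
      using u(3) v(3) by (intro add_less_le_mono mult_left_mono) auto
    also have "\<dots> \<le> norm w * (\<delta> / 2) + norm w * (\<delta> / 2)"
      using w1 \<delta> mult_right_mono [of 1 "norm w" "\<delta> / 2"] by (intro add_mono mult_right_mono) auto
    finally have Aw: "norm (A w) < \<delta> * norm w" by (simp add: mult.commute)
    let ?c = "complex_of_real (inverse (norm w))"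
    have w0: "norm w > 0" using w1(1) by linarith
    have n: "cmod ?c = inverse (norm w)" by (simp add: norm_inverse)
    show thesis
    proof
      show "norm (?c *\<^sub>C w) = 1" unfolding norm_scaleC n using w0 by simp
      show "cinner (?c *\<^sub>C w) f = 0" if "f \<in> F" for f
        using u(2) [OF that] v(2) [of f] that by (simp add: w_def cinner_simps)
      show "norm (A (?c *\<^sub>C w)) < \<delta>"
        unfolding bounded_clinear_scaleC [OF A] norm_scaleC n using w0 Aw by (simp add: field_simps)
      show "cinner (?c *\<^sub>C w) (C (?c *\<^sub>C w)) = 0"
        by (simp add: conjugation_scaleC [OF C] cinner_simps iso)
    qed
  qed
qed

lemma isotropic_approximate_eigenvector_sequence:
  fixes T :: "'a::complex_inner \<Rightarrow> 'a" and \<mu> :: "nat \<Rightarrow> complex"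
  assumes C: "conjugation C" and T: "bounded_clinear T"
    and not_ess: "\<And>n. \<not> ess_bounded_below (\<lambda>x. T x - \<mu> n *\<^sub>C x)" and \<delta>: "\<And>n. \<delta> n > 0"
  shows "\<exists>e. \<forall>n::nat. norm (e n) = 1 \<and> norm (T (e n) - \<mu> n *\<^sub>C e n) < \<delta> n \<and> cinner (e n) (C (e n)) = 0 \<and>
    (\<forall>m<n. cinner (e n) (e m) = 0 \<and> cinner (e n) (C (e m)) = 0 \<and> cinner (e n) (C (T (e m))) = 0)"
proof -
  define P where "P e n x \<longleftrightarrow> norm x = 1 \<and> norm (T x - \<mu> n *\<^sub>C x) < \<delta> n \<and> cinner x (C x) = 0 \<and>
    (\<forall>m<n. cinner x (e m) = 0 \<and> cinner x (C (e m)) = 0 \<and> cinner x (C (T (e m))) = 0)"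
    for e :: "nat \<Rightarrow> 'a" and n :: nat and x
  have "\<exists>e. \<forall>n. P e n (e n)"
  proof (rule dependent_wellorder_choice)
    fix n and e :: "nat \<Rightarrow> 'a"
    let ?F = "\<Union>m<n. {e m, C (e m), C (T (e m))}"
    obtain x where "norm x = 1" "\<And>f. f \<in> ?F \<Longrightarrow> cinner x f = 0" "norm (T x - \<mu> n *\<^sub>C x) < \<delta> n"
      "cinner x (C x) = 0"
      using isotropic_approximate_eigenvector [OF C bounded_clinear_shift [OF T] not_ess _ \<delta>, of ?F n n]
      by auto
    then have "P e n x" unfolding P_def by auto
    then show "\<exists>x. P e n x" by blast
  qed (simp add: P_def)
  then show ?thesis unfolding P_def .
qed

section \<open>Series of small symmetric operators\<close>

lemma C_symmetric_series:
  fixes J :: "nat \<Rightarrow> 'a::complex_hilbert_space \<Rightarrow> 'a"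
  assumes C: "conjugation C" and J: "\<And>n. C_symmetric C (J n)"
    and bound: "\<And>n x. norm (J n x) \<le> norm x * s n" and s: "summable s"
  shows "C_symmetric C (\<lambda>x. \<Sum>n. J n x)"
    and "\<And>x. norm (\<Sum>n. J n x) \<le> norm x * (\<Sum>n. s n)"
    and "\<And>\<eta>. \<eta> > 0 \<Longrightarrow> \<exists>N. \<forall>x. (\<forall>n<N. J n x = 0) \<longrightarrow> norm (\<Sum>n. J n x) \<le> \<eta> * norm x"
proof -
  have lin: "bounded_clinear (J n)" for n using J by (simp add: C_symmetric_def)
  have sum_s: "summable (\<lambda>n. norm x * s n)" for x :: 'a by (rule summable_mult [OF s])
  have norm_sum: "summable (\<lambda>n. norm (J n x))" for x
    by (rule summable_comparison_test' [OF sum_s [of x], of 0]) (use bound in simp)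
  then have sum_J: "summable (\<lambda>n. J n x)" for x by (rule summable_norm_cancel)
  have tail: "norm (\<Sum>n. J (n + N) x) \<le> norm x * (\<Sum>n. s (n + N))" for N x
  proof -
    have "norm (\<Sum>n. J (n + N) x) \<le> (\<Sum>n. norm (J (n + N) x))"
      by (rule summable_norm) (rule summable_ignore_initial_segment [OF norm_sum])
    also have "\<dots> \<le> (\<Sum>n. norm x * s (n + N))"
      by (rule suminf_le [OF bound]) (intro summable_ignore_initial_segment norm_sum sum_s
          summable_ignore_initial_segment [OF sum_s])+
    also have "\<dots> = norm x * (\<Sum>n. s (n + N))"
      by (rule suminf_mult [OF summable_ignore_initial_segment [OF s]])
    finally show ?thesis .
  qed
  show bnd: "norm (\<Sum>n. J n x) \<le> norm x * (\<Sum>n. s n)" for x using tail [of 0 x] by simp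
  have "bounded_clinear (\<lambda>x. \<Sum>n. J n x)"
  proof (rule bounded_clinearI [OF _ _ bnd])
    show "(\<Sum>n. J n (x + y)) = (\<Sum>n. J n x) + (\<Sum>n. J n y)" for x y
      unfolding bounded_clinear_add [OF lin] by (rule suminf_add [symmetric, OF sum_J sum_J])
    show "(\<Sum>n. J n (c *\<^sub>C x)) = c *\<^sub>C (\<Sum>n. J n x)" for c x
      unfolding bounded_clinear_scaleC [OF lin]
      by (rule bounded_linear.suminf [symmetric, OF bounded_linear_scaleC_right sum_J])
  qed
  moreover have "cinner (\<Sum>n. J n x) (C y) = cinner (\<Sum>n. J n y) (C x)" for x y
    unfolding bounded_linear.suminf [OF bounded_linear_cinner_left sum_J]
    using J unfolding C_symmetric_def by (intro arg_cong [where f = suminf] ext) blast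
  ultimately show "C_symmetric C (\<lambda>x. \<Sum>n. J n x)" by (simp add: C_symmetric_def)
  fix \<eta> :: real assume "\<eta> > 0"
  then obtain N where N: "norm (\<Sum>n. s (n + N)) < \<eta>" using suminf_exist_split [OF _ s] by blast
  have "norm (\<Sum>n. J n x) \<le> \<eta> * norm x" if "\<forall>n<N. J n x = 0" for x
  proof -
    have "(\<Sum>n. J n x) = (\<Sum>n. J (n + N) x)"
      using suminf_split_initial_segment [OF sum_J, of x N] that by simp
    also have "norm \<dots> \<le> norm x * \<eta>"
      by (rule order_trans [OF tail mult_left_mono]) (use N in auto)
    finally show ?thesis by (simp add: mult.commute)
  qed
  then show "\<exists>N. \<forall>x. (\<forall>n<N. J n x = 0) \<longrightarrow> norm (\<Sum>n. J n x) \<le> \<eta> * norm x" by blast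
qed

text \<open>The hypothesis on \<open>L\<close> expresses compactness: \<open>L\<close> is arbitrarily small on complements of finitely
  many vectors.\<close>

lemma ess_bounded_below_minus:
  assumes A: "ess_bounded_below A"
    and L: "\<And>\<eta>. \<eta> > 0 \<Longrightarrow> \<exists>F. finite F \<and> (\<forall>x. (\<forall>f\<in>F. cinner x f = 0) \<longrightarrow> norm (L x) \<le> \<eta> * norm x)"
  shows "ess_bounded_below (\<lambda>x. A x - L x)"
proof -
  obtain F d where F: "finite F" and d: "d > 0"
    and low: "\<And>x. (\<forall>f\<in>F. cinner x f = 0) \<Longrightarrow> d * norm x \<le> norm (A x)"
    using A unfolding ess_bounded_below_def by blast
  obtain G where G: "finite G" "\<And>x. (\<forall>f\<in>G. cinner x f = 0) \<Longrightarrow> norm (L x) \<le> d / 2 * norm x"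
    using L [of "d / 2"] d by auto
  have "d / 2 * norm x \<le> norm (A x - L x)" if "\<forall>f\<in>F \<union> G. cinner x f = 0" for x
    using low [of x] G(2) [of x] that norm_triangle_ineq2 [of "A x" "L x"] by auto
  then show ?thesis
    unfolding ess_bounded_below_def using F G(1) d
    by (intro exI [of _ "F \<union> G"] exI [of _ "d / 2"]) auto
qed

section \<open>Filling in discs around essential spectral points\<close>

text \<open>The approximate eigenvectors \<open>e n\<close> are turned into exact ones by a norm-convergent series of
  \<open>C\<close>-symmetric operators of finite rank. Its \<open>n\<close>-th term maps \<open>e n\<close> to the error \<open>g n\<close> and vanishes at
  the other \<open>e m\<close>, which is why \<open>e n\<close> is chosen orthogonal to \<open>C (T (e m))\<close>. \<open>C\<close>-symmetry then makes
  the \<open>C (e n)\<close> eigenvectors of the adjoint.\<close>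

lemma exact_eigenvectors:
  fixes T :: "'a::complex_hilbert_space \<Rightarrow> 'a" and \<mu> :: "nat \<Rightarrow> complex"
  assumes C: "conjugation C" and T: "C_symmetric C T" and \<eta>: "\<eta> > 0"
    and not_ess: "\<And>n. \<not> ess_bounded_below (\<lambda>x. T x - \<mu> n *\<^sub>C x)"
  shows "\<exists>e L. C_symmetric C L \<and> (\<forall>x. norm (L x) \<le> \<eta> * norm x) \<and>
    (\<forall>z. ess_bounded_below (\<lambda>x. T x - z *\<^sub>C x) \<longrightarrow> ess_bounded_below (\<lambda>x. T x - L x - z *\<^sub>C x)) \<and>
    orthonormal_on UNIV e \<and> (\<forall>m n. cinner (e m) (C (e n)) = 0) \<and>
    (\<forall>n. T (e n) - L (e n) = \<mu> n *\<^sub>C e n)"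
proof -
  have T_lin: "bounded_clinear T" using T by (simp add: C_symmetric_def)
  \<comment> \<open>The \<open>n\<close>-th correction will have norm at most \<open>3 \<delta> n\<close>, and these bounds add up to \<open>\<eta>\<close>.\<close>
  define \<delta> where "\<delta> n = \<eta> / 6 * (1 / 2) ^ n" for n
  have \<delta>_pos: "\<delta> n > 0" for n using \<eta> by (simp add: \<delta>_def)
  from isotropic_approximate_eigenvector_sequence [where \<mu> = \<mu> and \<delta> = \<delta>, OF C T_lin not_ess \<delta>_pos]
  obtain e :: "nat \<Rightarrow> 'a" where unit: "\<And>n. norm (e n) = 1"
    and small: "\<And>n. norm (T (e n) - \<mu> n *\<^sub>C e n) < \<delta> n"
    and iso: "\<And>n. cinner (e n) (C (e n)) = 0"
    and prev: "\<And>m n. m < n \<Longrightarrow>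
      cinner (e n) (e m) = 0 \<and> cinner (e n) (C (e m)) = 0 \<and> cinner (e n) (C (T (e m))) = 0"
    by blast
  have conj_sym: "cinner x (C y) = cinner y (C x)" for x y by (rule cinner_conjugation_right [OF C])
  have Tsym: "cinner (T x) (C y) = cinner (T y) (C x)" for x y using T unfolding C_symmetric_def by blast
  have orth: "cinner (e m) (e n) = 0" if "m \<noteq> n" for m n
  proof (cases "n < m")
    case False
    then have "cinner (e n) (e m) = 0" using prev that by simp
    then show ?thesis using cinner_commute [of "e m" "e n"] by simp
  qed (use prev in simp)
  have on: "orthonormal_on UNIV e"
    unfolding orthonormal_on_def using orth cinner_self [of "e _"] unit by auto
  have eCe: "cinner (e m) (C (e n)) = 0" for m n
    using prev [of m n] prev [of n m] iso conj_sym [of "e m" "e n"] by (cases m n rule: linorder_cases) auto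
  have eCTe: "cinner (e m) (C (T (e n))) = 0" if "m \<noteq> n" for m n
  proof (cases "n < m")
    case False
    have "cinner (e m) (C (T (e n))) = cinner (T (e n)) (C (e m))" by (rule conj_sym)
    also have "\<dots> = cinner (T (e m)) (C (e n))" by (rule Tsym)
    also have "\<dots> = cinner (e n) (C (T (e m)))" by (rule conj_sym)
    also have "\<dots> = 0" using prev [of m n] False that by simp
    finally show ?thesis .
  qed (use prev in simp)
  define g where "g n = T (e n) - \<mu> n *\<^sub>C e n" for n
  define \<zeta> where "\<zeta> n = cinner (g n) (C (e n))" for n
  have eCg: "cinner (e m) (C (g n)) = (if m = n then \<zeta> n else 0)" for m n
  proof (cases "m = n")
    case True
    then show ?thesis by (simp add: \<zeta>_def conj_sym [of "e n"])
  next
    case False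
    then show ?thesis
      by (simp add: g_def conjugation_diff [OF C] conjugation_scaleC [OF C] cinner_simps eCTe eCe)
  qed
  \<comment> \<open>The term \<open>cinner x (C (g n)) *\<^sub>C C (e n)\<close> makes \<open>J n\<close> symmetric, but it adds \<open>\<zeta> n *\<^sub>C C (e n)\<close> to
    the value at \<open>e n\<close>; the symmetric term with coefficient \<open>- \<zeta> n\<close> removes this again.\<close>
  define J where "J n x = cinner x (e n) *\<^sub>C (g n - \<zeta> n *\<^sub>C C (e n)) + cinner x (C (g n)) *\<^sub>C C (e n)" for n x
  have normC: "norm (C x) = norm x" for x by (rule norm_conjugation [OF C])
  have \<zeta>_le: "cmod (\<zeta> n) \<le> norm (g n)" for n
    using norm_cinner_le [of "g n" "C (e n)"] by (simp add: \<zeta>_def normC unit)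
  have J_bound: "norm (J n x) \<le> norm x * (3 * \<delta> n)" for n x
  proof -
    have "norm (g n - \<zeta> n *\<^sub>C C (e n)) \<le> norm (g n) + norm (g n)"
      by (rule norm_triangle_le_diff) (use \<zeta>_le [of n] in \<open>simp add: norm_scaleC normC unit\<close>)
    moreover have "cmod (cinner x (e n)) \<le> norm x" using norm_cinner_le [of x "e n"] by (simp add: unit)
    moreover have "cmod (cinner x (C (g n))) \<le> norm x * norm (g n)"
      using norm_cinner_le [of x "C (g n)"] by (simp add: normC)
    ultimately have "norm (J n x) \<le> norm x * (norm (g n) + norm (g n)) + norm x * norm (g n)"
      unfolding J_def
      by (intro norm_triangle_le add_mono) (auto simp: norm_scaleC normC unit intro!: mult_mono)
    also have "\<dots> = norm x * (3 * norm (g n))" by (simp add: algebra_simps)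
    also have "\<dots> \<le> norm x * (3 * \<delta> n)"
      using small [of n] by (intro mult_left_mono) (auto simp: g_def)
    finally show ?thesis .
  qed
  have J_sym: "C_symmetric C (J n)" for n
  proof -
    have lin: "bounded_clinear (J n)"
      unfolding J_def by (intro bounded_clinear_plus bounded_clinear_rank_one)
    have "cinner (J n x) (C y) = cinner x (e n) * cinner y (C (g n))
        - \<zeta> n * (cinner x (e n) * cinner y (e n)) + cinner x (C (g n)) * cinner y (e n)" for x y
      unfolding J_def using conj_sym [of "g n" y] cinner_conjugation [OF C, of "e n" y]
      by (simp add: cinner_simps algebra_simps)
    then show ?thesis unfolding C_symmetric_def using lin by (simp add: ac_simps)
  qed
  have sums_\<delta>: "(\<lambda>n. 3 * \<delta> n) sums \<eta>"
    using sums_mult [OF geometric_sums [of "1 / 2 :: real"], of "\<eta> / 2"] by (simp add: \<delta>_def)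
  note series = C_symmetric_series [where J = J, OF C J_sym J_bound sums_summable [OF sums_\<delta>]]
  define L where "L x = (\<Sum>n. J n x)" for x
  show ?thesis
  proof (intro exI [of _ e] exI [of _ L] conjI allI impI)
    show "C_symmetric C L" using series(1) by (simp add: L_def [abs_def])
    show "norm (L x) \<le> \<eta> * norm x" for x
      using series(2) [of x] sums_unique [OF sums_\<delta>] by (simp add: L_def mult.commute)
    show "ess_bounded_below (\<lambda>x. T x - L x - z *\<^sub>C x)" if "ess_bounded_below (\<lambda>x. T x - z *\<^sub>C x)" for z
    proof -
      have "ess_bounded_below (\<lambda>x. (T x - z *\<^sub>C x) - L x)"
      proof (rule ess_bounded_below_minus [OF that])
        fix \<epsilon> :: real assume "\<epsilon> > 0"
        then obtain N where N: "\<And>x. (\<forall>n<N. J n x = 0) \<Longrightarrow> norm (L x) \<le> \<epsilon> * norm x"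
          using series(3) unfolding L_def by blast
        let ?F = "(\<Union>n<N. {e n, C (g n)})"
        have "J n x = 0" if "\<forall>f\<in>?F. cinner x f = 0" "n < N" for n x
          using that by (auto simp: J_def)
        then show "\<exists>F. finite F \<and> (\<forall>x. (\<forall>f\<in>F. cinner x f = 0) \<longrightarrow> norm (L x) \<le> \<epsilon> * norm x)"
          using N by (intro exI [of _ ?F]) auto
      qed
      then show ?thesis by (simp add: algebra_simps)
    qed
    show "T (e n) - L (e n) = \<mu> n *\<^sub>C e n" for n
    proof -
      have "J k (e n) = (if k = n then g n else 0)" for k
        using orthonormal_onD [OF on, of n k] by (auto simp: J_def eCg)
      then have "L (e n) = g n"
        using sums_unique [OF sums_single [of n "\<lambda>_. g n"]] by (simp add: L_def)
      then show ?thesis by (simp add: g_def)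
    qed
  qed (use on eCe in auto)
qed

text \<open>Moving the eigenvalues of the exact eigenvectors inside the discs makes them dense there, and
  leaves the spectrum outside the discs unchanged.\<close>

lemma fill_discs:
  fixes T :: "'a::complex_hilbert_space \<Rightarrow> 'a"
  assumes C: "conjugation C" and T: "C_symmetric C T" and \<eta>: "\<eta> > 0" and r: "r > 0"
    and Z: "finite Z" "Z \<noteq> {}" and not_ess: "\<And>z. z \<in> Z \<Longrightarrow> \<not> ess_bounded_below (\<lambda>x. T x - z *\<^sub>C x)"
  shows "\<exists>K S. C_symmetric C K \<and> (\<forall>x. norm (K x) \<le> (\<eta> + 2 * r) * norm x) \<and> C_symmetric C S \<and>
    (\<forall>z. ess_bounded_below (\<lambda>x. T x - z *\<^sub>C x) \<longrightarrow> ess_bounded_below (\<lambda>x. S x - z *\<^sub>C x)) \<and>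
    spectrum (\<lambda>x. T x + K x) = spectrum S \<union> (\<Union>z\<in>Z. cball z r)"
proof -
  define D where "D = (\<Union>z\<in>Z. cball z r)"
  have D: "closed D" unfolding D_def using Z(1) by (intro closed_UN) auto
  obtain Q where Q: "countable Q" "Q \<subseteq> Z \<times> cball (0 :: complex) r" "Z \<times> cball 0 r \<subseteq> closure Q"
    using separable [of "Z \<times> cball (0 :: complex) r"] by blast
  have "Q \<noteq> {}" using Q(3) Z(2) r by auto
  \<comment> \<open>Each centre \<open>\<mu> n\<close> is paired with a shift \<open>c n\<close>, the pairs being dense in all admissible pairs.\<close>
  define \<mu> c where "\<mu> n = fst (from_nat_into Q n)" and "c n = snd (from_nat_into Q n)" for n
  have pair: "(\<mu> n, c n) \<in> Q" for n
    using from_nat_into [OF \<open>Q \<noteq> {}\<close>] by (simp add: \<mu>_def c_def)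
  have \<mu>: "\<mu> n \<in> Z" and c: "cmod (c n) \<le> r" for n using pair [of n] Q(2) by auto
  have dense: "\<exists>n. cmod (\<mu> n + c n - z) < \<epsilon>" if "z \<in> D" "\<epsilon> > 0" for z \<epsilon>
  proof -
    obtain w where w: "w \<in> Z" "z \<in> cball w r" using \<open>z \<in> D\<close> by (auto simp: D_def)
    then have "(w, z - w) \<in> closure Q"
      using Q(3) by (auto simp: dist_norm norm_minus_commute)
    then obtain q where q: "q \<in> Q" "dist q (w, z - w) < \<epsilon> / 2"
      using \<open>\<epsilon> > 0\<close> by (meson closure_approachable half_gt_zero)
    obtain n where n: "from_nat_into Q n = q" using from_nat_into_surj [OF Q(1) q(1)] by blast
    have "dist (\<mu> n) w < \<epsilon> / 2" "dist (c n) (z - w) < \<epsilon> / 2"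
      using q(2) dist_fst_le [of q "(w, z - w)"] dist_snd_le [of q "(w, z - w)"]
      by (auto simp: \<mu>_def c_def n)
    then have "cmod ((\<mu> n - w) + (c n - (z - w))) < \<epsilon>"
      unfolding dist_norm by (intro norm_triangle_lt) simp
    then show ?thesis by (auto simp: algebra_simps)
  qed
  have "\<not> ess_bounded_below (\<lambda>x. T x - \<mu> n *\<^sub>C x)" for n by (rule not_ess [OF \<mu>])
  from exact_eigenvectors [where \<mu> = \<mu>, OF C T \<eta> this]
  obtain e L where L: "C_symmetric C L" and "\<forall>x. norm (L x) \<le> \<eta> * norm x"
    and "\<forall>z. ess_bounded_below (\<lambda>x. T x - z *\<^sub>C x) \<longrightarrow> ess_bounded_below (\<lambda>x. T x - L x - z *\<^sub>C x)"
    and e: "orthonormal_on UNIV e" and "\<forall>m n. cinner (e m) (C (e n)) = 0"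
    and "\<forall>n. T (e n) - L (e n) = \<mu> n *\<^sub>C e n"
    by (elim exE conjE) (rule that)
  then have L_bound: "norm (L x) \<le> \<eta> * norm x"
    and ess: "ess_bounded_below (\<lambda>x. T x - z *\<^sub>C x) \<Longrightarrow> ess_bounded_below (\<lambda>x. T x - L x - z *\<^sub>C x)"
    and eCe: "cinner (e m) (C (e n)) = 0" and eig: "T (e n) - L (e n) = \<mu> n *\<^sub>C e n" for x z m n
    by (simp_all only: simp_thms)
  define f where "f n = C (e n)" for n
  have f: "orthonormal_on UNIV f"
    unfolding orthonormal_on_def f_def cinner_conjugation [OF C] using orthonormal_onD [OF e] by auto
  have ef: "cinner (e m) (f n) = 0" for m n by (simp add: f_def eCe)
  have fe: "cinner (e m) (e n) = (if m = n then 1 else 0)" for m n using orthonormal_onD [OF e] by auto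
  define S where "S x = T x - L x" for x
  have S: "C_symmetric C S" unfolding S_def by (rule C_symmetric_diff [OF C T L])
  define N where "N x = diagonal e c x + diagonal f c x" for x
  have N: "C_symmetric C N"
  proof -
    have "cinner (diagonal e c x) (C y) = cinner (diagonal f c y) (C x)" for x y
    proof -
      have "cinner (e n) (C y) = cinner y (f n)" "cinner (f n) (C x) = cinner x (e n)" for n
        unfolding f_def by (rule cinner_conjugation_right [OF C]) (rule cinner_conjugation [OF C])
      then show ?thesis
        unfolding bounded_linear_diagonal [OF e c bounded_linear_cinner_left]
          bounded_linear_diagonal [OF f c bounded_linear_cinner_left] cinner_scaleC_left
        by (simp add: mult_ac)
    qed
    then show ?thesis
      unfolding C_symmetric_def N_def
      by (simp add: bounded_clinear_plus bounded_clinear_diagonal [OF e c]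
          bounded_clinear_diagonal [OF f c] cinner_add_left)
  qed
  define Y where "Y x = S x + N x" for x
  have Y: "C_symmetric C Y" unfolding Y_def by (rule C_symmetric_add [OF C S N])
  have Se: "S (e n) = \<mu> n *\<^sub>C e n" for n by (simp add: S_def eig)
  have "diagonal f c (e n) = 0" for n unfolding diagonal_def ef by simp
  then have Ye: "Y (e n) = (\<mu> n + c n) *\<^sub>C e n" for n
    by (simp add: Y_def N_def Se diagonal_basis [OF e c] scaleC_add_left)
  have adj: "cinner (A x) (f n) = \<alpha> n * cinner x (f n)"
    if "C_symmetric C A" "\<And>n. A (e n) = \<alpha> n *\<^sub>C e n" for A \<alpha> x n
  proof -
    have "cinner (A x) (f n) = cinner (A (e n)) (C x)"
      using that(1) unfolding C_symmetric_def f_def by blast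
    then show ?thesis
      using that(2) cinner_conjugation_right [OF C, of "e n" x] by (simp add: cinner_scaleC_left f_def)
  qed
  have S_eq: "S x = Y x + diagonal e (\<lambda>n. - c n) x + diagonal f (\<lambda>n. - c n) x" for x
  proof -
    have neg: "cmod (- c n) \<le> r" for n using c [of n] by simp
    have zero: "diagonal e c x + diagonal e (\<lambda>n. - c n) x = 0" "diagonal f c x + diagonal f (\<lambda>n. - c n) x = 0"
      unfolding diagonal_add [OF e c neg] diagonal_add [OF f c neg] by (simp_all add: diagonal_def)
    have "Y x + diagonal e (\<lambda>n. - c n) x + diagonal f (\<lambda>n. - c n) x
        = S x + (diagonal e c x + diagonal e (\<lambda>n. - c n) x) + (diagonal f c x + diagonal f (\<lambda>n. - c n) x)"
      unfolding Y_def N_def by (simp only: ac_simps)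
    then show ?thesis unfolding zero by simp
  qed
  have lin: "bounded_clinear S" "bounded_clinear Y" using S Y by (simp_all add: C_symmetric_def)
  have outside: "z \<in> spectrum Y \<longleftrightarrow> z \<in> spectrum S" if z: "z \<notin> D" for z
  proof -
    obtain d where d: "d > 0" "ball z d \<subseteq> - D"
      using D z by (metis ComplI open_Compl open_contains_ball)
    have gap: "d \<le> cmod (w - z)" if "w \<in> D" for w
      using d(2) that by (force simp: dist_norm norm_minus_commute)
    have D_mem: "\<mu> n \<in> D" "\<mu> n + c n \<in> D" for n
      using \<mu> [of n] c [of n] r by (auto simp: D_def dist_norm intro!: bexI [of _ "\<mu> n"])
    have "bounded_below (\<lambda>x. Y x - z *\<^sub>C x)" if bb: "bounded_below (\<lambda>x. S x - z *\<^sub>C x)"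
      using bounded_below_change_eigenvalues [OF lin(1) e f ef Se adj [OF S Se] c d(1) _ _ bb] D_mem gap
      by (simp add: Y_def N_def add.assoc)
    moreover have "bounded_below (\<lambda>x. S x - z *\<^sub>C x)" if bb: "bounded_below (\<lambda>x. Y x - z *\<^sub>C x)"
    proof -
      have neg: "cmod (- c n) \<le> r" for n using c [of n] by simp
      show ?thesis
        unfolding S_eq
        using bounded_below_change_eigenvalues [OF lin(2) e f ef Ye adj [OF Y Ye] neg d(1) _ _ bb]
          D_mem gap by simp
    qed
    ultimately show ?thesis
      unfolding C_symmetric_spectrum_iff [OF C Y] C_symmetric_spectrum_iff [OF C S] by blast
  qed
  have inside: "z \<in> spectrum Y" if z: "z \<in> D" for z
  proof (rule ccontr)
    assume "z \<notin> spectrum Y"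
    then obtain d where d: "d > 0" "\<And>x. d * norm x \<le> norm (Y x - z *\<^sub>C x)"
      by (auto simp: C_symmetric_spectrum_iff [OF C Y] bounded_below_def)
    obtain n where n: "cmod (\<mu> n + c n - z) < d" using dense [OF z d(1)] by blast
    have "Y (e n) - z *\<^sub>C e n = (\<mu> n + c n - z) *\<^sub>C e n"
      by (simp add: Ye complex_scaling.scale_left_diff_distrib)
    then show False
      using d(2) [of "e n"] n orthonormal_norm [OF e, of n] by (simp add: norm_scaleC)
  qed
  show ?thesis
  proof (rule exI [of _ "\<lambda>x. N x - L x"], rule exI [of _ S], intro conjI allI impI)
    show "C_symmetric C (\<lambda>x. N x - L x)" by (rule C_symmetric_diff [OF C N L])
    show "norm (N x - L x) \<le> (\<eta> + 2 * r) * norm x" for x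
    proof -
      have "norm (N x) \<le> norm x * r + norm x * r"
        unfolding N_def by (intro norm_triangle_le add_mono norm_diagonal e f c)
      then show ?thesis
        using L_bound [of x] norm_triangle_ineq4 [of "N x" "L x"] by (simp add: algebra_simps)
    qed
    show "ess_bounded_below (\<lambda>x. S x - z *\<^sub>C x)" if "ess_bounded_below (\<lambda>x. T x - z *\<^sub>C x)" for z
      unfolding S_def by (rule ess [OF that])
    have "(\<lambda>x. T x + (N x - L x)) = Y" by (auto simp: Y_def S_def algebra_simps)
    then show "spectrum (\<lambda>x. T x + (N x - L x)) = spectrum S \<union> (\<Union>z\<in>Z. cball z r)"
      using outside inside by (auto simp: D_def [symmetric])
  qed (use S in auto)
qed

section \<open>Compactness and the number of components\<close>

lemma finite_components_Union_connected:
  fixes \<C> :: "'a::topological_space set set"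
  assumes fin: "finite \<C>" and conn: "\<And>X. X \<in> \<C> \<Longrightarrow> connected X"
  shows "finite (components (\<Union>\<C>))"
proof -
  have "components (\<Union>\<C>) \<subseteq> (\<lambda>X. connected_component_set (\<Union>\<C>) (SOME y. y \<in> X)) ` \<C>"
  proof
    fix K assume "K \<in> components (\<Union>\<C>)"
    then obtain x X where x: "x \<in> X" "X \<in> \<C>" and K: "K = connected_component_set (\<Union>\<C>) x"
      unfolding components_def by auto
    have "(SOME y. y \<in> X) \<in> X" using x(1) by (rule someI)
    then have "connected_component (\<Union>\<C>) x (SOME y. y \<in> X)"
      unfolding connected_component_def using x conn by blast
    then have "K = connected_component_set (\<Union>\<C>) (SOME y. y \<in> X)"
      unfolding K by (metis connected_component_eq mem_Collect_eq)
    then show "K \<in> (\<lambda>X. connected_component_set (\<Union>\<C>) (SOME y. y \<in> X)) ` \<C>" using x(2) by blast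
  qed
  then show ?thesis using fin finite_surj by blast
qed

text \<open>Off the open discs the spectrum is locally a point or a ball, so by compactness finitely many
  points and balls cover what the discs do not.\<close>

lemma finite_components_spectrum_Un_discs:
  fixes S :: "'a::complex_hilbert_space \<Rightarrow> 'a"
  assumes C: "conjugation C" and S: "C_symmetric C S" and Z: "finite Z"
    and ess: "\<And>z. z \<notin> (\<Union>w\<in>Z. ball w r) \<Longrightarrow> ess_bounded_below (\<lambda>x. S x - z *\<^sub>C x)"
  shows "finite (components (spectrum S \<union> (\<Union>w\<in>Z. cball w r)))"
proof -
  define M where "M = spectrum S - (\<Union>w\<in>Z. ball w r)"
  have "compact M"
    unfolding M_def compact_eq_bounded_closed
    using bounded_spectrum_C_symmetric [OF C S] closed_spectrum_C_symmetric [OF C S]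
    by (auto intro!: bounded_diff closed_Diff)
  have "\<exists>s. s > 0 \<and> (ball p s \<inter> spectrum S \<subseteq> {p} \<or> ball p s \<subseteq> spectrum S)" if "p \<in> M" for p
    using spectrum_near_ess_bounded_below [OF C S ess, of p] that unfolding M_def by (metis DiffD2)
  then obtain s where s: "\<And>p. p \<in> M \<Longrightarrow> s p > 0"
    "\<And>p. p \<in> M \<Longrightarrow> ball p (s p) \<inter> spectrum S \<subseteq> {p} \<or> ball p (s p) \<subseteq> spectrum S"
    by metis
  have "M \<subseteq> (\<Union>p\<in>M. ball p (s p))"
    by (rule subsetI, rule UN_I, assumption) (simp add: s(1))
  then obtain P where P: "P \<subseteq> M" "finite P" "M \<subseteq> (\<Union>p\<in>P. ball p (s p))"
    by (rule compactE_image [where f = "\<lambda>p. ball p (s p)", OF \<open>compact M\<close> open_ball])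
  let ?\<C> = "(\<lambda>w. cball w r) ` Z \<union> (\<lambda>p. ball p (s p) \<inter> spectrum S) ` P"
  have "spectrum S \<union> (\<Union>w\<in>Z. cball w r) = \<Union>?\<C>"
  proof
    have "x \<in> (\<Union>w\<in>Z. cball w r) \<union> (\<Union>p\<in>P. ball p (s p) \<inter> spectrum S)" if x: "x \<in> spectrum S" for x
    proof (cases "x \<in> (\<Union>w\<in>Z. cball w r)")
      case False
      then have "x \<in> M" using x by (auto simp: M_def)
      then obtain p where "p \<in> P" "x \<in> ball p (s p)" using P(3) by (meson UN_E subsetD)
      then show ?thesis using x by (intro UnI2 UN_I [of p] IntI)
    qed simp
    then show "spectrum S \<union> (\<Union>w\<in>Z. cball w r) \<subseteq> \<Union>?\<C>"
      unfolding Union_Un_distrib by (rule Un_least [OF subsetI Un_upper1])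
    show "\<Union>?\<C> \<subseteq> spectrum S \<union> (\<Union>w\<in>Z. cball w r)"
      unfolding Union_Un_distrib by (rule Un_least [OF Un_upper2 UN_least]) (rule le_supI1, rule Int_lower2)
  qed
  moreover have "finite (components (\<Union>?\<C>))"
  proof (rule finite_components_Union_connected)
    show "finite ?\<C>" using Z P(2) by simp
    fix X assume "X \<in> ?\<C>"
    then consider w where "X = cball w r" | p where "p \<in> P" "X = ball p (s p) \<inter> spectrum S" by auto
    then show "connected X"
    proof cases
      case 2
      then have "X \<subseteq> {p} \<or> X = ball p (s p)" using s(2) P(1) by blast
      then show ?thesis by (metis connected_ball connected_empty connected_sing subset_singletonD)
    qed simp
  qed
  ultimately show ?thesis by simp
qed

lemma compact_not_ess_bounded_below:
  fixes T :: "'a::complex_hilbert_space \<Rightarrow> 'a"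
  assumes C: "conjugation C" and T: "C_symmetric C T"
  shows "compact {z. \<not> ess_bounded_below (\<lambda>x. T x - z *\<^sub>C x)}" (is "compact ?E")
proof -
  have "?E \<subseteq> spectrum T"
    unfolding C_symmetric_spectrum_iff [OF C T, abs_def] subset_iff
    by (auto simp: ess_bounded_below_def bounded_below_def C_symmetric_spectrum_iff [OF C T])
  then have "bounded ?E" using bounded_spectrum_C_symmetric [OF C T] bounded_subset by blast
  moreover have "open (- ?E)"
    unfolding open_contains_ball
  proof
    fix z assume "z \<in> - ?E"
    then obtain F d where F: "finite F" and d: "d > 0"
      and low: "\<And>x. (\<forall>f\<in>F. cinner x f = 0) \<Longrightarrow> d * norm x \<le> norm (T x - z *\<^sub>C x)"
      unfolding ess_bounded_below_def by blast
    have "ess_bounded_below (\<lambda>x. T x - w *\<^sub>C x)" if "w \<in> ball z d" for w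
      unfolding ess_bounded_below_def
    proof (intro exI conjI allI impI)
      show "finite F" by (rule F)
      show "d - cmod (w - z) > 0" using that by (simp add: dist_norm norm_minus_commute)
      fix x assume "\<forall>f\<in>F. cinner x f = 0"
      then show "(d - cmod (w - z)) * norm x \<le> norm (T x - w *\<^sub>C x)"
        using low [of x] norm_shift_change [of T x z w] by (simp add: algebra_simps)
    qed
    then show "\<exists>s>0. ball z s \<subseteq> - ?E" using d by blast
  qed
  ultimately show ?thesis by (simp add: compact_eq_bounded_closed closed_def)
qed

theorem theorem3p8:
  fixes T :: "'a::complex_hilbert_space \<Rightarrow> 'a" and \<epsilon> :: real
  assumes "separable_space (euclidean :: 'a topology)"
    and "bounded_clinear T"
    and "complex_symmetric T"
    and "\<epsilon> > 0"
  shows "\<exists>K. bounded_clinear K \<and> onorm K < \<epsilon> \<and>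
    complex_symmetric (\<lambda>x. T x + K x) \<and>
    finite (components (spectrum (\<lambda>x. T x + K x)))"
proof -
  obtain C where C: "conjugation C" and T: "C_symmetric C T"
    using complex_symmetricE [OF assms(3)] by blast
  let ?E = "{z. \<not> ess_bounded_below (\<lambda>x. T x - z *\<^sub>C x)}"
  \<comment> \<open>Filling discs of radius \<open>r\<close> costs \<open>2 * r\<close>, since the two corner blocks both change.\<close>
  define r where "r = \<epsilon> / 8"
  have r: "r > 0" using assms(4) by (simp add: r_def)
  have "?E \<subseteq> (\<Union>w\<in>?E. ball w r)" by (rule subsetI, rule UN_I, assumption) (simp add: r)
  then obtain Z where Z: "Z \<subseteq> ?E" "finite Z" and cover: "?E \<subseteq> (\<Union>w\<in>Z. ball w r)"
    by (rule compactE_image [where f = "\<lambda>w. ball w r", OF compact_not_ess_bounded_below [OF C T] open_ball])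
  have "\<exists>K S. C_symmetric C K \<and> (\<forall>x. norm (K x) \<le> (\<epsilon> / 4 + 2 * r) * norm x) \<and> C_symmetric C S \<and>
    (\<forall>z. ess_bounded_below (\<lambda>x. T x - z *\<^sub>C x) \<longrightarrow> ess_bounded_below (\<lambda>x. S x - z *\<^sub>C x)) \<and>
    spectrum (\<lambda>x. T x + K x) = spectrum S \<union> (\<Union>w\<in>Z. cball w r)"
  proof (cases "Z = {}")
    case True
    have "C_symmetric C (\<lambda>x. 0)" using C_symmetric_finite_sum [OF C, of "{}"] by simp
    then show ?thesis
      using T True r assms(4) by - (rule exI [of _ "\<lambda>x. 0"], rule exI [of _ T], simp)
  next
    case False
    then show ?thesis using Z r assms(4) by (intro fill_discs [OF C T]) auto
  qed
  then obtain K S where K: "C_symmetric C K" and K_bound: "\<forall>x. norm (K x) \<le> (\<epsilon> / 4 + 2 * r) * norm x"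
    and S: "C_symmetric C S"
    and ess: "\<forall>z. ess_bounded_below (\<lambda>x. T x - z *\<^sub>C x) \<longrightarrow> ess_bounded_below (\<lambda>x. S x - z *\<^sub>C x)"
    and spec: "spectrum (\<lambda>x. T x + K x) = spectrum S \<union> (\<Union>w\<in>Z. cball w r)"
    by (elim exE conjE) (rule that)
  have "onorm K \<le> \<epsilon> / 2" using K_bound assms(4) by (intro onorm_bound) (auto simp: r_def)
  moreover have "finite (components (spectrum (\<lambda>x. T x + K x)))"
    unfolding spec using cover ess by (intro finite_components_spectrum_Un_discs [OF C S Z(2)]) blast
  moreover have "complex_symmetric (\<lambda>x. T x + K x)"
    by (rule complex_symmetricI [OF C C_symmetric_add [OF C T K]])
  ultimately show ?thesis using K assms(4) by (intro exI [of _ K]) (auto simp: C_symmetric_def)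
qed

end
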